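(* Let $H$ be a covering $3$-hypergraph. Then $H$ is eulerian if and only if it has at least two edges.
   Context: A hypergraph $H=(V,E)$ has a non-empty finite vertex set $V$ and a finite collection $E$ of edges, each associated with a subset of $V$; parallel edges (distinct edges with the same vertex set) are allowed, so $E$ is a multiset of subsets of $V$ and edges are counted with multiplicity. A covering $3$-hypergraph is a hypergraph with at least one edge in which every edge has exactly $3$ vertices and every $2$-subset of the vertex set is contained in at least one edge. A walk is a sequence $v_0e_1v_1\dots v_{k-1}e_kv_k$ ($k\ge 0$) of vertices $v_i$ and edges $e_i$ such that $v_{i-1}\neq v_i$ and $v_{i-1},v_i\in e_i$ for all $i=1,\dots,k$; it is closed if $v_0=v_k$. It is a strict trail if $e_1,\dots,e_k$ are pairwise distinct edges. An Euler tour of $H$ is a closed strict trail traversing every edge of $H$ exactly once. $H$ is eulerian if it admits an Euler tour. *)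

theory Defs
  imports Main
begin

text \<open>
  Edges are labels, and the map \<open>ends\<close> assigns to every edge the set of vertices it is
  associated with. The map need not be injective, so parallel edges are allowed, and
  \<open>card (edges H)\<close> counts edges with multiplicity.
\<close>

record ('v, 'e) hypergraph =
  verts :: "'v set"
  edges :: "'e set"
  ends  :: "'e \<Rightarrow> 'v set"

definition is_hypergraph :: "('v, 'e) hypergraph \<Rightarrow> bool" where
  "is_hypergraph H \<longleftrightarrow>
     finite (verts H) \<and> verts H \<noteq> {} \<and> finite (edges H) \<and>
     (\<forall>e\<in>edges H. ends H e \<subseteq> verts H)"

definition covering_3_hypergraph :: "('v, 'e) hypergraph \<Rightarrow> bool" where
  "covering_3_hypergraph H \<longleftrightarrow>
     is_hypergraph H \<and> edges H \<noteq> {} \<and>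
     (\<forall>e\<in>edges H. card (ends H e) = 3) \<and>
     (\<forall>S. S \<subseteq> verts H \<and> card S = 2 \<longrightarrow> (\<exists>e\<in>edges H. S \<subseteq> ends H e))"

text \<open>
  The sequence \<open>v\<^sub>0 e\<^sub>1 v\<^sub>1 \<dots> e\<^sub>k v\<^sub>k\<close> is given by the list \<open>vs\<close> of its \<open>k + 1\<close> vertices and
  the list \<open>es\<close> of its \<open>k\<close> edges; lists are indexed from 0, so \<open>e\<^sub>i\<^sub>+\<^sub>1\<close> is \<open>es ! i\<close>.
\<close>

definition walk :: "('v, 'e) hypergraph \<Rightarrow> 'v list \<Rightarrow> 'e list \<Rightarrow> bool" where
  "walk H vs es \<longleftrightarrow>
     length vs = Suc (length es) \<and> set vs \<subseteq> verts H \<and> set es \<subseteq> edges H \<and>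
     (\<forall>i<length es. vs ! i \<noteq> vs ! Suc i \<and>
        vs ! i \<in> ends H (es ! i) \<and> vs ! Suc i \<in> ends H (es ! i))"

definition closed_walk :: "('v, 'e) hypergraph \<Rightarrow> 'v list \<Rightarrow> 'e list \<Rightarrow> bool" where
  "closed_walk H vs es \<longleftrightarrow> walk H vs es \<and> hd vs = last vs"

definition strict_trail :: "('v, 'e) hypergraph \<Rightarrow> 'v list \<Rightarrow> 'e list \<Rightarrow> bool" where
  "strict_trail H vs es \<longleftrightarrow> walk H vs es \<and> distinct es"

definition euler_tour :: "('v, 'e) hypergraph \<Rightarrow> 'v list \<Rightarrow> 'e list \<Rightarrow> bool" where
  "euler_tour H vs es \<longleftrightarrow>
     closed_walk H vs es \<and> strict_trail H vs es \<and>
     (\<forall>e\<in>edges H. count_list es e = 1)"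

definition eulerian :: "('v, 'e) hypergraph \<Rightarrow> bool" where
  "eulerian H \<longleftrightarrow> (\<exists>vs es. euler_tour H vs es)"

end

theory Submission
  imports Defs
begin

text \<open>
  To traverse an edge of three vertices means to pick two of them. If every edge picks a pair so
  that in the multigraph of all picked pairs each degree is even and the picked pairs hang
  together, an Euler circuit of this multigraph is an Euler tour of the hypergraph. So the task is
  to find such a choice of pairs.

  The only tool is the \<^emph>\<open>flip\<close>: in an edge with vertices \<open>s\<close>, \<open>w\<close>, \<open>t\<close> the picked pair
  \<open>{s, t}\<close> may be replaced by \<open>{w, t}\<close>, or conversely. This changes the parity of the degrees of
  \<open>s\<close> and \<open>w\<close> and of nothing else, and it is possible for any two vertices of the edge unless they
  are just the picked pair. An edge that has not picked a pair yet may flip any two of its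
  vertices by picking them. Flips of distinct edges compose: along a closed walk of flips all
  parities are restored.

  \<^emph>\<open>Parity.\<close> Take an even choice in which as many edges as possible have picked a pair, and suppose
  that \<open>e\<close> has not. Then no two vertices of \<open>e\<close> are joined by a walk of flips of other edges, all
  distinct. Suppose first that another edge shares two vertices with \<open>e\<close>. Grow a set \<open>K\<close> of
  vertices from \<open>ends e\<close> such that any two of its vertices can be made the only odd ones by
  altering edges inside \<open>K\<close> (\<open>blossom\<close>, in the spirit of Edmonds). A fresh edge on two vertices of
  \<open>K\<close> must have picked just these, hence its third vertex is new and can be added, and so on
  forever, contradicting finiteness (\<open>no_blossom\<close>). Otherwise, for each \<open>x\<close> in \<open>e\<close> let \<open>near x\<close> be
  the vertices reached from \<open>x\<close> by at most two flips of edges containing \<open>x\<close>. The three sets are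
  disjoint, yet each contains at least half of the vertices outside \<open>e\<close>
  (\<open>near_disjoint\<close>, \<open>near_large\<close>). So there are only three vertices, and \<open>e\<close> is the only edge.

  \<^emph>\<open>Connectedness.\<close> Among all even choices take one with a largest set \<open>B\<close> of mutually linked
  vertices. Any closed walk of flips that links something new to \<open>B\<close> and does not tear \<open>B\<close> apart
  is impossible; since an even graph has no bridge, \<open>B\<close> survives whenever at most one
  affected pair lies in \<open>B\<close> (\<open>cheap_flips\<close>). This excludes edges outside \<open>B\<close> (\<open>no_edge_outside\<close>), so two
  vertices \<open>q\<close>, \<open>r\<close> outside \<open>B\<close> always lie in an edge \<open>{q, r, b}\<close> with \<open>b\<close> in \<open>B\<close> that has picked
  \<open>{q, r}\<close>. By evenness \<open>q\<close> then has two such labels \<open>b\<close> and \<open>b'\<close>, and an edge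
  on \<open>{b, b', w}\<close> has picked \<open>{b, b'}\<close>. Whether \<open>w\<close> lies in \<open>B\<close> or not, a closed walk of flips
  through \<open>q\<close>, \<open>w\<close> and one of the labels enlarges \<open>B\<close>, although it affects two pairs in \<open>B\<close>
  (\<open>third_not_in_B\<close>, \<open>third_in_B\<close>). So at most one vertex is outside \<open>B\<close>, and all picked pairs lie
  inside \<open>B\<close>.
\<close>

section \<open>Finite sets and linked vertices\<close>

lemma card_2_eq_doubleton:
  assumes "card P = 2" "x \<in> P" "y \<in> P" "x \<noteq> y"
  shows "P = {x, y}"
  using assms by (metis card_2_iff insert_iff singletonD insert_commute)

lemma pair_in_triple:
  assumes "P \<subseteq> {s, w, t}" "card P = 2"
  shows "P = {s, w} \<or> P = {s, t} \<or> P = {w, t}"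
  using assms by (auto simp: card_2_iff)

lemma odd_card_split:
  assumes "finite A" "g \<in> A"
  shows "odd (card {h \<in> A. P h}) \<longleftrightarrow> (P g \<noteq> odd (card {h \<in> A - {g}. P h}))"
proof (cases "P g")
  case True
  then have "{h \<in> A. P h} = insert g {h \<in> A - {g}. P h}" using assms by auto
  then show ?thesis using True assms by simp
next
  case False
  then have "{h \<in> A. P h} = {h \<in> A - {g}. P h}" by auto
  then show ?thesis using False by simp
qed

lemma handshake:
  assumes "finite C" "finite F"
  shows "(\<Sum>x\<in>C. card {g \<in> F. x \<in> c g}) = (\<Sum>g\<in>F. card (c g \<inter> C))"
proof -
  have "(\<Sum>x\<in>C. card {g \<in> F. x \<in> c g}) = (\<Sum>x\<in>C. \<Sum>g\<in>F. if x \<in> c g then 1 else 0)"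
    using assms by (intro sum.cong refl) (simp flip: sum.inter_filter)
  also have "\<dots> = (\<Sum>g\<in>F. \<Sum>x\<in>C. if x \<in> c g then 1 else 0)" by (rule sum.swap)
  also have "\<dots> = (\<Sum>g\<in>F. card (c g \<inter> C))"
  proof (rule sum.cong[OF refl])
    fix g
    have "{x \<in> C. x \<in> c g} = c g \<inter> C" by blast
    then show "(\<Sum>x\<in>C. if x \<in> c g then 1 else 0) = card (c g \<inter> C)"
      using assms by (simp flip: sum.inter_filter)
  qed
  finally show ?thesis .
qed

text \<open>
  A map \<open>c\<close> from edges to sets of vertices is read as a multigraph in which the edge \<open>g\<close> joins the
  elements of \<open>c g\<close>; \<open>F\<close> restricts it to some of the edges.
\<close>

definition rel :: "'e set \<Rightarrow> ('e \<Rightarrow> 'v set) \<Rightarrow> ('v \<times> 'v) set" where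
  "rel F c = {(u, v). \<exists>g\<in>F. u \<in> c g \<and> v \<in> c g}"

abbreviation linked :: "'e set \<Rightarrow> ('e \<Rightarrow> 'v set) \<Rightarrow> 'v \<Rightarrow> 'v \<Rightarrow> bool" where
  "linked F c u v \<equiv> (u, v) \<in> (rel F c)\<^sup>*"

lemma linked_edge: "g \<in> F \<Longrightarrow> u \<in> c g \<Longrightarrow> v \<in> c g \<Longrightarrow> linked F c u v"
  by (rule r_into_rtrancl) (auto simp: rel_def)

lemma linked_sym: "linked F c u v \<Longrightarrow> linked F c v u"
proof -
  have "sym (rel F c)" by (auto simp: rel_def intro: symI)
  then show "linked F c u v \<Longrightarrow> linked F c v u" by (meson sym_rtrancl symD)
qed

lemma linked_trans: "linked F c u v \<Longrightarrow> linked F c v w \<Longrightarrow> linked F c u w"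
  by (rule rtrancl_trans)

text \<open>
  This is how a walk in one multigraph is imitated in another one: if \<open>X\<close> is closed under the edges
  in \<open>F\<close>, only the edges inside \<open>X\<close> have to be imitated.
\<close>

lemma linked_transfer:
  assumes "linked F c u v" "u \<in> X"
    and "\<And>g x. g \<in> F \<Longrightarrow> x \<in> c g \<Longrightarrow> x \<in> X \<Longrightarrow> c g \<subseteq> X"
    and "\<And>g x y. g \<in> F \<Longrightarrow> c g \<subseteq> X \<Longrightarrow> x \<in> c g \<Longrightarrow> y \<in> c g \<Longrightarrow> linked G d x y"
  shows "linked G d u v \<and> v \<in> X"
  using assms(1)
proof (induction rule: rtrancl_induct)
  case base
  then show ?case using assms(2) by simp
next
  case (step y z)
  then obtain g where g: "g \<in> F" "y \<in> c g" "z \<in> c g" by (auto simp: rel_def)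
  then have "c g \<subseteq> X" using assms(3) step.IH by blast
  moreover from this have "linked G d y z" using assms(4)[OF g(1) _ g(2,3)] by simp
  then have "linked G d u z" using step.IH by (metis linked_trans)
  ultimately show ?case using g(3) by blast
qed

text \<open>
  A walk through \<open>g\<close> can be cut at its first arrival at and its last departure from \<open>c g\<close>.
\<close>

lemma linked_add_edge:
  assumes "linked F c x y"
  shows "linked (F - {g}) c x y \<or>
    (\<exists>p\<in>c g. \<exists>p'\<in>c g. linked (F - {g}) c x p \<and> linked (F - {g}) c p' y)"
  using assms
proof (induction rule: rtrancl_induct)
  case base
  then show ?case by simp
next
  case (step y z)
  then obtain h where h: "h \<in> F" "y \<in> c h" "z \<in> c h" by (auto simp: rel_def)
  show ?case
  proof (cases "h = g")
    case True
    then show ?thesis using h step.IH by blast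
  next
    case False
    then have yz: "linked (F - {g}) c y z" using h linked_edge[of h "F - {g}" y c z] by simp
    from step.IH show ?thesis
    proof
      assume "linked (F - {g}) c x y"
      from linked_trans[OF this yz] show ?thesis ..
    next
      assume "\<exists>p\<in>c g. \<exists>p'\<in>c g. linked (F - {g}) c x p \<and> linked (F - {g}) c p' y"
      then obtain p p' where p: "p \<in> c g" "p' \<in> c g" "linked (F - {g}) c x p"
        "linked (F - {g}) c p' y" by blast
      from linked_trans[OF p(4) yz] show ?thesis using p(1-3) by blast
    qed
  qed
qed

lemma linked_exit:
  assumes "linked F d u v" "u \<in> U" "v \<notin> U"
  obtains g x y where "g \<in> F" "x \<in> d g" "y \<in> d g" "x \<in> U" "y \<notin> U"
proof -
  have "v \<notin> U \<longrightarrow> (\<exists>g\<in>F. \<exists>x y. x \<in> d g \<and> y \<in> d g \<and> x \<in> U \<and> y \<notin> U)"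
    using assms(1)
  proof (induction rule: rtrancl_induct)
    case base
    then show ?case using assms(2) by simp
  next
    case (step y z)
    then show ?case unfolding rel_def by blast
  qed
  then show ?thesis using that assms(3) by blast
qed

section \<open>Picking pairs and flipping them\<close>

locale triple_cover =
  fixes V :: "'v set" and E :: "'e set" and ends :: "'e \<Rightarrow> 'v set"
  assumes finite_V: "finite V" and finite_E: "finite E"
    and ends_subset: "g \<in> E \<Longrightarrow> ends g \<subseteq> V"
    and card_ends: "g \<in> E \<Longrightarrow> card (ends g) = 3"
    and cover: "u \<in> V \<Longrightarrow> v \<in> V \<Longrightarrow> u \<noteq> v \<Longrightarrow> \<exists>g\<in>E. u \<in> ends g \<and> v \<in> ends g"
begin

text \<open>
  The value \<open>{}\<close> means that the edge has not picked a pair yet.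
\<close>

definition valid :: "('e \<Rightarrow> 'v set) \<Rightarrow> bool" where
  "valid c \<longleftrightarrow> (\<forall>g\<in>E. c g = {} \<or> card (c g) = 2 \<and> c g \<subseteq> ends g)"

definition odd_at :: "('e \<Rightarrow> 'v set) \<Rightarrow> 'v \<Rightarrow> bool" where
  "odd_at c x \<longleftrightarrow> odd (card {g \<in> E. x \<in> c g})"

definition flippable :: "('e \<Rightarrow> 'v set) \<Rightarrow> 'e \<Rightarrow> 'v \<Rightarrow> 'v \<Rightarrow> bool" where
  "flippable c g s w \<longleftrightarrow> g \<in> E \<and> s \<noteq> w \<and> s \<in> ends g \<and> w \<in> ends g \<and> c g \<noteq> {s, w}"

text \<open>
  If \<open>c g\<close> has exactly one of \<open>s\<close>, \<open>w\<close>, the symmetric difference exchanges them; if \<open>c g\<close> is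
  empty, it picks both. The excluded case \<open>c g = {s, w}\<close> would unpick the edge.
\<close>

definition flip :: "('e \<Rightarrow> 'v set) \<Rightarrow> 'e \<Rightarrow> 'v \<Rightarrow> 'v \<Rightarrow> 'e \<Rightarrow> 'v set" where
  "flip c g s w = c(g := sym_diff (c g) {s, w})"

lemma third_vertex:
  assumes "g \<in> E" "s \<in> ends g" "w \<in> ends g" "s \<noteq> w"
  obtains t where "ends g = {s, w, t}" "t \<noteq> s" "t \<noteq> w" "t \<in> V"
proof -
  have "card (ends g - {s, w}) = 1"
    using assms card_ends[of g] by (subst card_Diff_subset) auto
  then obtain t where t: "ends g - {s, w} = {t}" by (auto simp: card_1_singleton_iff)
  then have "ends g = {s, w, t}" "t \<noteq> s" "t \<noteq> w" "t \<in> V"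
    using assms ends_subset[of g] by auto
  then show ?thesis by (rule that)
qed

lemma flip_pair:
  assumes "valid c" "flippable c g s w"
  shows "card (sym_diff (c g) {s, w}) = 2" "sym_diff (c g) {s, w} \<subseteq> ends g"
proof -
  obtain t where t: "ends g = {s, w, t}" "t \<noteq> s" "t \<noteq> w"
    using assms(2) third_vertex unfolding flippable_def by metis
  have sw: "s \<noteq> w" "c g \<noteq> {s, w}" "g \<in> E" using assms(2) by (auto simp: flippable_def)
  have "c g = {} \<or> c g = {s, t} \<or> c g = {w, t}"
    using assms(1) sw pair_in_triple[of "c g" s w t] t unfolding valid_def by auto
  \<comment> \<open>An unused edge gets the pair \<open>{s, w}\<close>; in a used one \<open>s\<close> and \<open>w\<close> trade places.\<close>
  moreover have "sym_diff {} {s, w} = {s, w}" "sym_diff {s, t} {s, w} = {t, w}"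
      "sym_diff {w, t} {s, w} = {t, s}"
    using t sw(1) by auto
  ultimately have "sym_diff (c g) {s, w} = {s, w} \<or> sym_diff (c g) {s, w} = {t, w} \<or>
      sym_diff (c g) {s, w} = {t, s}"
    by metis
  then obtain x y where "sym_diff (c g) {s, w} = {x, y}" "x \<noteq> y" "{x, y} \<subseteq> ends g"
    using t sw(1) by blast
  then show "card (sym_diff (c g) {s, w}) = 2" "sym_diff (c g) {s, w} \<subseteq> ends g"
    by simp_all
qed

lemma valid_flip: "valid c \<Longrightarrow> flippable c g s w \<Longrightarrow> valid (flip c g s w)"
  using flip_pair[of c g s w] unfolding valid_def flip_def by (simp del: Un_subset_iff)

lemma flip_nonempty:
  assumes "valid c" "flippable c g s w"
  shows "flip c g s w g \<noteq> {}"
  using flip_pair(1)[OF assms] by (metis card.empty flip_def fun_upd_same zero_neq_numeral)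

lemma flip_other [simp]: "h \<noteq> g \<Longrightarrow> flip c g s w h = c h"
  by (simp add: flip_def)

text \<open>
  Everything about parity rests on this: a flip behaves like a graph edge between \<open>s\<close> and \<open>w\<close>,
  whatever the third vertex of \<open>g\<close> is.
\<close>

lemma odd_at_flip:
  assumes "flippable c g s w"
  shows "odd_at (flip c g s w) x \<longleftrightarrow> (odd_at c x \<noteq> ((x = s) \<noteq> (x = w)))"
proof -
  have g: "g \<in> E" "s \<noteq> w" using assms by (auto simp: flippable_def)
  have "{h \<in> E - {g}. x \<in> flip c g s w h} = {h \<in> E - {g}. x \<in> c h}" by auto
  moreover have "x \<in> flip c g s w g \<longleftrightarrow> ((x \<in> c g) \<noteq> ((x = s) \<noteq> (x = w)))"
    using g by (auto simp: flip_def)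
  ultimately show ?thesis unfolding odd_at_def
    using odd_card_split[OF finite_E g(1), of "\<lambda>h. x \<in> c h"]
      odd_card_split[OF finite_E g(1), of "\<lambda>h. x \<in> flip c g s w h"] by auto
qed

end

section \<open>All edges can pick pairs with even degrees\<close>

text \<open>
  An even choice that cannot be extended, and an edge \<open>e\<close> left out by it. All lemmas here work
  towards the contradiction that follows as soon as there is a second edge.
\<close>

locale maximal_choice = triple_cover V E ends
  for V :: "'v set" and E :: "'e set" and ends :: "'e \<Rightarrow> 'v set" +
  fixes c :: "'e \<Rightarrow> 'v set" and e :: 'e
  assumes valid_c: "valid c" and even_c: "\<not> odd_at c x"
    and max_c: "valid d \<Longrightarrow> (\<And>x. \<not> odd_at d x) \<Longrightarrow>
      card {g \<in> E. d g \<noteq> {}} \<le> card {g \<in> E. c g \<noteq> {}}"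
    and e: "e \<in> E" "c e = {}"
begin

text \<open>
  Altering \<open>c\<close> on \<open>T\<close> only, \<open>e\<close> gets picked as well, at the price of making \<open>u\<close> and \<open>v\<close> odd. Any
  flip that repairs \<open>u\<close> and \<open>v\<close> would beat the maximal choice.
\<close>

definition connects :: "'e set \<Rightarrow> 'v \<Rightarrow> 'v \<Rightarrow> bool" where
  "connects T u v \<longleftrightarrow> u \<noteq> v \<and> (\<exists>d. valid d \<and> (\<forall>g. g \<notin> T \<longrightarrow> d g = c g) \<and>
     (\<forall>g\<in>E. c g \<noteq> {} \<longrightarrow> d g \<noteq> {}) \<and> d e \<noteq> {} \<and>
     (\<forall>x. odd_at d x \<longleftrightarrow> (x = u) \<noteq> (x = v)))"

lemma connects_sym: "connects T u v \<Longrightarrow> connects T v u"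
  unfolding connects_def by metis

lemma connects_mono:
  assumes "connects T u v" "T \<subseteq> T'"
  shows "connects T' u v"
proof -
  have "(\<forall>g. g \<notin> T \<longrightarrow> d g = c g) \<Longrightarrow> (\<forall>g. g \<notin> T' \<longrightarrow> d g = c g)" for d
    using assms(2) by blast
  then show ?thesis using assms(1) unfolding connects_def by metis
qed

lemma connects_start:
  assumes "u \<in> ends e" "v \<in> ends e" "u \<noteq> v"
  shows "connects {e} u v"
proof -
  have f: "flippable c e u v" using assms e by (auto simp: flippable_def)
  let ?d = "flip c e u v"
  have "?d h \<noteq> {}" if "c h \<noteq> {}" for h
    using that e(2) by (cases "h = e") auto
  moreover have "\<forall>h. h \<notin> {e} \<longrightarrow> ?d h = c h" by simp
  moreover have "\<forall>x. odd_at ?d x \<longleftrightarrow> (x = u) \<noteq> (x = v)" using odd_at_flip[OF f] even_c by blast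
  ultimately show ?thesis unfolding connects_def
    using assms(3) valid_flip[OF valid_c f] flip_nonempty[OF valid_c f] by blast
qed

text \<open>
  A flip of a fresh edge moves the odd vertex \<open>s\<close> to \<open>w\<close>. It cannot hit the other odd vertex, since
  the resulting even choice would use \<open>e\<close> in addition to all edges used by \<open>c\<close>.
\<close>

lemma flip_on_connects:
  assumes "connects T s v" "flippable c g s w" "g \<notin> T"
  shows "w \<noteq> v \<and> connects (insert g T) w v"
proof -
  obtain d where d: "valid d" "\<And>g. g \<notin> T \<Longrightarrow> d g = c g"
     "\<And>g. g \<in> E \<Longrightarrow> c g \<noteq> {} \<Longrightarrow> d g \<noteq> {}" "d e \<noteq> {}"
     "\<And>x. odd_at d x \<longleftrightarrow> (x = s) \<noteq> (x = v)" and sv: "s \<noteq> v"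
    using assms(1) unfolding connects_def by metis
  have f: "flippable d g s w" using assms(2,3) d(2) by (auto simp: flippable_def)
  let ?d = "flip d g s w"
  have val: "valid ?d" using valid_flip[OF d(1) f] .
  have used: "?d h \<noteq> {}" if "h \<in> E" "c h \<noteq> {} \<or> h = e" for h
    using flip_nonempty[OF d(1) f] d(3)[of h] d(4) that by (cases "h = g") auto
  have odd: "odd_at ?d x \<longleftrightarrow> (x = w) \<noteq> (x = v)" for x
    using odd_at_flip[OF f, of x] d(5)[of x] by auto
  have "w \<noteq> v"
  proof
    assume "w = v"
    then have "card {g \<in> E. ?d g \<noteq> {}} \<le> card {g \<in> E. c g \<noteq> {}}"
      using max_c[OF val] odd by auto
    moreover have "{g \<in> E. c g \<noteq> {}} \<subset> {g \<in> E. ?d g \<noteq> {}}"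
      using used e by blast
    moreover have "finite {g \<in> E. ?d g \<noteq> {}}" using finite_E by simp
    ultimately show False by (metis (no_types, lifting) leD psubset_card_mono)
  qed
  moreover have "\<forall>h. h \<notin> insert g T \<longrightarrow> ?d h = c h" using d(2) by simp
  moreover have "\<forall>h\<in>E. c h \<noteq> {} \<longrightarrow> ?d h \<noteq> {}" "?d e \<noteq> {}" using used e(1) by blast+
  ultimately have "connects (insert g T) w v"
    unfolding connects_def using val odd by blast
  with \<open>w \<noteq> v\<close> show ?thesis by blast
qed

lemma connects_close:
  assumes "connects T u v" "g \<in> E" "g \<notin> T" "u \<in> ends g" "v \<in> ends g"
  shows "c g = {u, v}"
proof (rule ccontr)
  assume "c g \<noteq> {u, v}"
  moreover have "u \<noteq> v" using assms(1) by (auto simp: connects_def)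
  ultimately have "flippable c g u v" using assms by (auto simp: flippable_def)
  then show False using flip_on_connects[OF assms(1) _ assms(3)] by blast
qed

text \<open>
  Any two vertices of \<open>K\<close> are equally good as odd vertices, much like the vertices of a contracted
  odd cycle in Edmonds' matching algorithm. The last condition provides the edge for the next step.
\<close>

definition blossom :: "'v set \<Rightarrow> 'e set \<Rightarrow> bool" where
  "blossom K T \<longleftrightarrow> T \<subseteq> E \<and> K \<subseteq> V \<and> 3 \<le> card K \<and> (\<forall>t\<in>T. ends t \<subseteq> K) \<and>
     (\<forall>u\<in>K. \<forall>v\<in>K. u \<noteq> v \<longrightarrow> connects T u v) \<and>
     (\<exists>g\<in>E - T. \<exists>w\<in>K. \<exists>r\<in>K. w \<noteq> r \<and> w \<in> ends g \<and> r \<in> ends g)"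

text \<open>
  A fresh edge on \<open>w\<close> and \<open>r\<close> must have picked \<open>{w, r}\<close>, so its third vertex \<open>z\<close> can be flipped with
  both of them. Hence \<open>z\<close> is not in \<open>K\<close>, and \<open>z\<close> replaces \<open>w\<close> or \<open>r\<close> as an odd vertex, whichever
  is not the other one.
\<close>

lemma blossom_grows:
  assumes "blossom K T"
  obtains z T' where "z \<notin> K" "blossom (insert z K) T'"
proof -
  note B = assms[unfolded blossom_def]
  obtain g w r where g: "g \<in> E" "g \<notin> T" "w \<in> K" "r \<in> K" "w \<noteq> r" "w \<in> ends g" "r \<in> ends g"
    using B by blast
  have con: "connects T u v" if "u \<in> K" "v \<in> K" "u \<noteq> v" for u v using B that by blast
  have finK: "finite K" using B finite_V finite_subset by blast
  have cg: "c g = {w, r}" using connects_close[OF con] g by blast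
  obtain z where z: "ends g = {w, r, z}" "z \<noteq> w" "z \<noteq> r" "z \<in> V"
    using third_vertex[of g w r] g by metis
  have zK: "z \<notin> K"
  proof
    assume "z \<in> K"
    then have "c g = {w, z}" using connects_close[OF con, of w z g] g z by auto
    then show False using cg z by (auto simp: doubleton_eq_iff)
  qed
  have flz: "flippable c g w z" "flippable c g r z"
    using g z cg by (auto simp: flippable_def doubleton_eq_iff)
  have conz: "connects (insert g T) z v" if "v \<in> K" for v
  proof (cases "v = w")
    case True
    then show ?thesis
      using flip_on_connects[OF con[of r w] flz(2)] g by auto
  next
    case False
    then show ?thesis
      using flip_on_connects[OF con[of w v] flz(1)] g that by auto
  qed
  \<comment> \<open>The only edge of \<open>insert g T\<close> at the new vertex \<open>z\<close> is \<open>g\<close>, so a third vertex of \<open>K\<close>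
    gives a pair covered by a fresh edge, and the growth can go on.\<close>
  have "card {w, r} < card K" using B g by (simp add: card_insert_if)
  then obtain r' where r': "r' \<in> K" "r' \<noteq> w" "r' \<noteq> r"
    by (metis card_mono finite.intros insertCI leD subsetI)
  obtain g' where g': "g' \<in> E" "z \<in> ends g'" "r' \<in> ends g'"
    using cover[of z r'] z r' B zK by blast
  have g'T: "g' \<notin> insert g T" using g' z r' zK B by auto
  have "blossom (insert z K) (insert g T)" unfolding blossom_def
  proof (intro conjI)
    show "insert g T \<subseteq> E" using B g by auto
    show "insert z K \<subseteq> V" using B z by auto
    show "3 \<le> card (insert z K)" using B finK zK by simp
    show "\<forall>t\<in>insert g T. ends t \<subseteq> insert z K" using B z g by auto
    show "\<forall>u\<in>insert z K. \<forall>v\<in>insert z K. u \<noteq> v \<longrightarrow> connects (insert g T) u v"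
      using conz connects_sym con connects_mono[OF con, of _ _ "insert g T"] by blast
    show "\<exists>ga\<in>E - insert g T. \<exists>w\<in>insert z K. \<exists>r\<in>insert z K.
        w \<noteq> r \<and> w \<in> ends ga \<and> r \<in> ends ga"
      using g' g'T r' zK
      by (intro bexI[of _ g'] bexI[of _ z] bexI[of _ r']) auto
  qed
  then show ?thesis using that zK by blast
qed

lemma no_blossom: "\<not> blossom K T"
proof
  assume "blossom K T"
  then show False
  proof (induction "card (V - K)" arbitrary: K T rule: less_induct)
    case less
    obtain z T' where z: "z \<notin> K" "blossom (insert z K) T'"
      using blossom_grows[OF less.prems] .
    then have "z \<in> V" by (auto simp: blossom_def)
    then have "card (V - insert z K) < card (V - K)"
      using z finite_V by (intro psubset_card_mono) auto
    then show False by (rule less.hyps[OF _ z(2)])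
  qed
qed

lemma unused_shares_no_pair:
  assumes "g \<in> E" "g \<noteq> e" "x \<in> ends e" "y \<in> ends e" "x \<noteq> y" "x \<in> ends g"
  shows "y \<notin> ends g"
proof
  assume "y \<in> ends g"
  have "blossom (ends e) {e}" unfolding blossom_def
  proof (intro conjI)
    show "\<forall>u\<in>ends e. \<forall>v\<in>ends e. u \<noteq> v \<longrightarrow> connects {e} u v" using connects_start by blast
    show "\<exists>g\<in>E - {e}. \<exists>w\<in>ends e. \<exists>r\<in>ends e. w \<noteq> r \<and> w \<in> ends g \<and> r \<in> ends g"
      using assms \<open>y \<in> ends g\<close> by (intro bexI[of _ g] bexI[of _ x] bexI[of _ y]) auto
  qed (use e card_ends[OF e(1)] ends_subset[OF e(1)] in auto)
  then show False using no_blossom by blast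
qed

text \<open>
  The second disjunct matters when many edges at \<open>x\<close> share their third vertex: then one flip alone
  reaches too few vertices to count with.
\<close>

definition near :: "'v \<Rightarrow> 'v set" where
  "near x = {p \<in> V - ends e.
     (\<exists>g. g \<noteq> e \<and> flippable c g x p) \<or>
     (\<exists>g h y. g \<noteq> e \<and> h \<noteq> e \<and> g \<noteq> h \<and> x \<in> ends h \<and> flippable c g x y \<and> flippable c h y p)}"

lemma near_one_flip: "p \<in> V - ends e \<Longrightarrow> g \<noteq> e \<Longrightarrow> flippable c g x p \<Longrightarrow> p \<in> near x"
  unfolding near_def by auto

lemma near_two_flips:
  assumes "p \<in> V - ends e" "g \<noteq> e" "h \<noteq> e" "g \<noteq> h" "x \<in> ends h"
    "flippable c g x y" "flippable c h y p"
  shows "p \<in> near x"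
  using assms unfolding near_def by auto

lemma connects_near:
  assumes con: "connects T x v" and p: "p \<in> near x"
    and T: "\<And>g. g \<in> E \<Longrightarrow> g \<noteq> e \<Longrightarrow> x \<in> ends g \<Longrightarrow> g \<notin> T"
  obtains S where "p \<noteq> v" "connects (T \<union> S) p v"
     "\<And>g. g \<in> S \<Longrightarrow> g \<in> E \<and> g \<noteq> e \<and> x \<in> ends g"
proof -
  from p consider (one) g where "g \<noteq> e" "flippable c g x p"
    | (two) g h y where "g \<noteq> e" "h \<noteq> e" "g \<noteq> h" "x \<in> ends h" "flippable c g x y" "flippable c h y p"
    unfolding near_def by blast
  then show ?thesis
  proof cases
    case one
    then have g: "g \<in> E" "x \<in> ends g" by (auto simp: flippable_def)
    from flip_on_connects[OF con one(2) T[OF g(1) one(1) g(2)]]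
    show ?thesis using that[of "{g}"] g one by auto
  next
    case two
    then have g: "g \<in> E" "x \<in> ends g" "h \<in> E" by (auto simp: flippable_def)
    have 1: "connects (insert g T) y v"
      using flip_on_connects[OF con two(5) T[OF g(1) two(1) g(2)]] by blast
    have "h \<notin> insert g T" using T[OF g(3) two(2) two(4)] two(3) by blast
    from flip_on_connects[OF 1 two(6) this]
    show ?thesis using that[of "{g, h}"] g two by (auto simp: insert_commute)
  qed
qed

text \<open>
  A common vertex of \<open>near x\<close> and \<open>near y\<close> would join \<open>x\<close> and \<open>y\<close> by flips. The edges on the two
  sides are distinct, because only \<open>e\<close> contains both \<open>x\<close> and \<open>y\<close>.
\<close>

lemma near_disjoint:
  assumes "x \<in> ends e" "y \<in> ends e" "x \<noteq> y"
  shows "near x \<inter> near y = {}"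
proof (rule ccontr)
  assume "near x \<inter> near y \<noteq> {}"
  then obtain p where p: "p \<in> near x" "p \<in> near y" by blast
  obtain S where S: "connects ({e} \<union> S) p y" "\<And>g. g \<in> S \<Longrightarrow> g \<in> E \<and> g \<noteq> e \<and> x \<in> ends g"
    using connects_near[OF connects_start[OF assms] p(1)] by auto
  have "g \<notin> {e} \<union> S" if "g \<in> E" "g \<noteq> e" "y \<in> ends g" for g
    using that S(2)[of g] unused_shares_no_pair[of g y x] assms by auto
  from connects_near[OF connects_sym[OF S(1)] p(2) this] show False by blast
qed

text \<open>
  A vertex \<open>p\<close> outside \<open>near x\<close> lies in an edge \<open>{x, p, y}\<close> that has picked \<open>{x, p}\<close>, and then \<open>y\<close>
  is near \<open>x\<close>. The map from \<open>p\<close> to \<open>y\<close> is injective, so at most half of the vertices are missed.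
\<close>

lemma near_large:
  assumes x: "x \<in> ends e"
  shows "card (V - ends e) \<le> 2 * card (near x)"
proof -
  let ?P = "V - ends e - near x"
  have "\<exists>y g. g \<in> E \<and> g \<noteq> e \<and> ends g = {x, p, y} \<and> c g = {x, p} \<and> y \<in> near x \<and> y \<noteq> p \<and> y \<noteq> x"
    if p: "p \<in> ?P" for p
  proof -
    have "x \<in> V" "x \<noteq> p" using x p ends_subset e by auto
    then obtain g where g: "g \<in> E" "x \<in> ends g" "p \<in> ends g" using cover[of x p] p by auto
    then have ge: "g \<noteq> e" using p by auto
    obtain y where y: "ends g = {x, p, y}" "y \<noteq> x" "y \<noteq> p" "y \<in> V"
      using third_vertex[OF g \<open>x \<noteq> p\<close>] .
    have cg: "c g = {x, p}"
      using p g ge \<open>x \<noteq> p\<close> unfolding near_def flippable_def by auto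
    have "y \<notin> ends e" using unused_shares_no_pair[of g x y] g ge x y by auto
    moreover have "flippable c g x y" using g y cg by (auto simp: flippable_def doubleton_eq_iff)
    ultimately have "y \<in> near x" using y ge near_one_flip by simp
    then show ?thesis using g ge y cg by blast
  qed
  then obtain y g where yg: "\<And>p. p \<in> ?P \<Longrightarrow> g p \<in> E \<and> g p \<noteq> e \<and> ends (g p) = {x, p, y p} \<and>
      c (g p) = {x, p} \<and> y p \<in> near x \<and> y p \<noteq> p \<and> y p \<noteq> x"
    by metis
  \<comment> \<open>If \<open>p\<close> and \<open>p'\<close> had the same \<open>y\<close>, flipping \<open>g p'\<close> from \<open>x\<close> to \<open>y\<close> and then \<open>g p\<close> from \<open>y\<close>
    to \<open>p\<close> would put \<open>p\<close> near \<open>x\<close>.\<close>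
  have "inj_on y ?P"
  proof (rule inj_onI, rule ccontr)
    fix p p' assume p: "p \<in> ?P" "p' \<in> ?P" "y p = y p'" "p \<noteq> p'"
    note a = yg[OF p(1)] yg[OF p(2)]
    have px: "p \<noteq> x" "p' \<noteq> x" using p x by auto
    have yp: "y p \<noteq> p" "y p \<noteq> p'" "y p \<noteq> x" using a p(3) by metis+
    have "{x, p} \<noteq> {x, p'}" "{x, p'} \<noteq> {x, y p}" "{x, p} \<noteq> {y p, p}"
      using yp px p(4) by (metis doubleton_eq_iff)+
    moreover have "c (g p) = {x, p}" "c (g p') = {x, p'}" using a by blast+
    ultimately have "g p \<noteq> g p'" "c (g p') \<noteq> {x, y p}" "c (g p) \<noteq> {y p, p}" by metis+
    moreover have "g p \<in> E" "g p \<noteq> e" "y p \<in> ends (g p)" "p \<in> ends (g p)" "x \<in> ends (g p)"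
      "g p' \<in> E" "g p' \<noteq> e" "y p \<in> ends (g p')" "x \<in> ends (g p')"
      using a p(3) by simp_all
    ultimately have "flippable c (g p') x (y p)" "flippable c (g p) (y p) p"
      using yp by (auto simp only: flippable_def)
    then have "p \<in> near x"
      using near_two_flips[of p "g p'" "g p" x "y p"] p(1)
        \<open>g p \<noteq> g p'\<close> \<open>g p \<noteq> e\<close> \<open>g p' \<noteq> e\<close> \<open>x \<in> ends (g p)\<close> by auto
    then show False using p by blast
  qed
  moreover have "y ` ?P \<subseteq> near x" using yg by blast
  moreover have fin: "finite (near x)" using finite_V by (auto simp: near_def)
  ultimately have "card ?P \<le> card (near x)" by (rule card_inj_on_le)
  moreover have "card (V - ends e) = card ?P + card (near x)"
  proof -
    have "near x \<subseteq> V - ends e" by (auto simp: near_def)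
    then show ?thesis using fin finite_V
      by (metis add.commute card_Un_disjoint Diff_disjoint Diff_partition finite_Diff)
  qed
  ultimately show ?thesis by linarith
qed

lemma unused_edge_is_only_edge: "E = {e}"
proof (rule ccontr)
  assume "E \<noteq> {e}"
  then obtain f where f: "f \<in> E" "f \<noteq> e" using e by blast
  obtain a b d where abd: "ends e = {a, b, d}" "a \<noteq> b" "a \<noteq> d" "b \<noteq> d"
    using card_ends[OF e(1)] by (auto simp: card_3_iff)
  have sub: "near x \<subseteq> V - ends e" "finite (near x)" for x
    using finite_V by (auto simp: near_def)
  have "card (near a \<union> near b \<union> near d) = card (near a) + card (near b) + card (near d)"
    using near_disjoint abd sub(2) by (subst card_Un_disjoint; simp add: Int_Un_distrib2)+
  moreover have "card (near a \<union> near b \<union> near d) \<le> card (V - ends e)"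
    using sub finite_V by (intro card_mono) auto
  \<comment> \<open>Three disjoint sets, each at least half of \<open>V - ends e\<close>.\<close>
  ultimately have "card (V - ends e) = 0"
    using near_large[of a] near_large[of b] near_large[of d] abd by simp
  then have "V = ends e" using finite_V ends_subset[OF e(1)] by auto
  then have "ends f = ends e"
    using ends_subset[OF f(1)] card_ends f(1) e(1) by (metis card_subset_eq finite_V)
  then show False using unused_shares_no_pair[of f a b] abd f by auto
qed

end

context triple_cover
begin

definition even_choice :: "('e \<Rightarrow> 'v set) \<Rightarrow> bool" where
  "even_choice c \<longleftrightarrow> valid c \<and> (\<forall>g\<in>E. c g \<noteq> {}) \<and> (\<forall>x. \<not> odd_at c x)"

lemma even_choice_exists:
  assumes "2 \<le> card E"
  shows "\<exists>c. even_choice c"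
proof -
  let ?P = "\<lambda>c. valid c \<and> (\<forall>x. \<not> odd_at c x)"
  let ?used = "\<lambda>c. card {g \<in> E. c g \<noteq> {}}"
  \<comment> \<open>The maximum ranges over partial choices; the empty one is even.\<close>
  have start: "?P (\<lambda>_. {})" by (simp add: valid_def odd_at_def)
  have bound: "\<forall>c. ?P c \<longrightarrow> ?used c < Suc (card E)"
    using finite_E by (intro allI impI le_imp_less_Suc card_mono) auto
  obtain c where c: "?P c" "\<forall>d. ?P d \<longrightarrow> ?used d \<le> ?used c"
    using ex_has_greatest_nat[of ?P, OF start bound] by blast
  have "c e \<noteq> {}" if "e \<in> E" for e
  proof
    assume "c e = {}"
    then interpret maximal_choice V E ends c e
      using c that by unfold_locales auto
    show False using unused_edge_is_only_edge assms by simp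
  qed
  then show ?thesis using c unfolding even_choice_def by blast
qed

section \<open>Even multigraphs of picked pairs\<close>

lemma even_choice_pair:
  assumes "even_choice c" "g \<in> E"
  shows "card (c g) = 2" "c g \<subseteq> ends g" "c g \<subseteq> V"
proof -
  show "card (c g) = 2" "c g \<subseteq> ends g"
    using assms unfolding even_choice_def valid_def by blast+
  then show "c g \<subseteq> V" using ends_subset[OF assms(2)] by blast
qed

lemma even_choice_card:
  "even_choice c \<Longrightarrow> even (card {g \<in> E. x \<in> c g})"
  unfolding even_choice_def odd_at_def by blast

lemma no_bridge:
  assumes c: "even_choice c" and g: "g \<in> E" "u \<in> c g" "v \<in> c g"
  shows "linked (E - {g}) c u v"
proof (rule ccontr)
  let ?F = "E - {g}"
  define C where "C = {x \<in> V. linked ?F c u x}"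
  assume not: "\<not> linked ?F c u v"
  then have uv: "u \<noteq> v" by auto
  have cg: "c g = {u, v}" by (rule card_2_eq_doubleton[OF even_choice_pair(1)[OF c g(1)] g(2,3) uv])
  have uC: "u \<in> C" using even_choice_pair(3)[OF c g(1)] g by (auto simp: C_def)
  have vC: "v \<notin> C" using not by (simp add: C_def)
  have finC: "finite C" using finite_V by (simp add: C_def)
  \<comment> \<open>No edge other than \<open>g\<close> leaves \<open>C\<close>, so the degrees inside \<open>C\<close> sum to an even number although
    \<open>u\<close> is the only vertex of \<open>C\<close> that lost a pair.\<close>
  have "even (card (c h \<inter> C))" if h: "h \<in> ?F" for h
  proof (cases "c h \<inter> C = {}")
    case False
    then obtain x where x: "x \<in> c h" "linked ?F c u x" by (auto simp: C_def)
    have "c h \<subseteq> C"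
    proof
      fix y assume y: "y \<in> c h"
      have "linked ?F c x y" using h x(1) y by (rule linked_edge)
      with x(2) have "linked ?F c u y" by (rule linked_trans)
      then show "y \<in> C" using y even_choice_pair(3)[OF c, of h] h by (auto simp: C_def)
    qed
    then have "c h \<inter> C = c h" by blast
    then show ?thesis using even_choice_pair(1)[OF c, of h] h by simp
  qed simp
  then have 1: "even (\<Sum>x\<in>C. card {h \<in> ?F. x \<in> c h})"
    unfolding handshake[OF finC finite_Diff[OF finite_E]] by (rule dvd_sum)
  have deg: "odd (card {h \<in> ?F. x \<in> c h}) \<longleftrightarrow> x \<in> c g" for x
    using odd_card_split[OF finite_E g(1), of "\<lambda>h. x \<in> c h"] even_choice_card[OF c, of x] by blast
  have "even (card {h \<in> ?F. x \<in> c h})" if "x \<in> C - {u}" for x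
    using deg[of x] that cg vC by auto
  then have 2: "even (\<Sum>x\<in>C - {u}. card {h \<in> ?F. x \<in> c h})" by (rule dvd_sum)
  have "(\<Sum>x\<in>C. card {h \<in> ?F. x \<in> c h}) =
      card {h \<in> ?F. u \<in> c h} + (\<Sum>x\<in>C - {u}. card {h \<in> ?F. x \<in> c h})"
    using finC uC by (rule sum.remove)
  then show False using 1 2 deg[of u] g(2) by simp
qed

text \<open>
  If the removal separates the endpoints of one pair, then the other pair was the only detour between
  them, so it runs between the same two parts.
\<close>

lemma two_removed:
  assumes c: "even_choice c" and g: "g \<in> E" "c g = {w, w'}" and k: "k \<in> E" "c k = {b, b1}"
    and L: "L = linked (E - {g, k}) c"
  shows "L w w' \<and> L b b1 \<or> L w b \<and> L w' b1 \<or> L w b1 \<and> L w' b"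
proof -
  have sym: "L x y \<Longrightarrow> L y x" for x y unfolding L by (rule linked_sym)
  have trans: "L x y \<Longrightarrow> L y z \<Longrightarrow> L x z" for x y z unfolding L by (rule linked_trans)
  have E1: "E - {g} - {k} = E - {g, k}" and E2: "E - {k} - {g} = E - {g, k}" by auto
  have 1: "L w w' \<or> (\<exists>p\<in>c k. \<exists>p'\<in>c k. L w p \<and> L p' w')"
    using linked_add_edge[OF no_bridge[OF c g(1), of w w'], of k] g(2) unfolding L E1 by simp
  have 2: "L b b1 \<or> (\<exists>p\<in>c g. \<exists>p'\<in>c g. L b p \<and> L p' b1)"
    using linked_add_edge[OF no_bridge[OF c k(1), of b b1], of g] k(2) unfolding L E2 by simp
  show ?thesis
  proof (cases "L w w'")
    case True
    then have "L p p'" if "p \<in> c g" "p' \<in> c g" for p p'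
      using that g(2) sym[OF True] by (auto simp: L)
    then have "L b b1" using 2 trans by metis
    then show ?thesis using True by blast
  next
    case False
    then obtain p p' where p: "p \<in> c k" "p' \<in> c k" "L w p" "L p' w'" using 1 by blast
    then have "p \<noteq> p'" using False trans by blast
    then have "p = b \<and> p' = b1 \<or> p = b1 \<and> p' = b" using p k(2) by auto
    then show ?thesis using p(3) sym[OF p(4)] by blast
  qed
qed

section \<open>Closed walks of flips\<close>

fun flips :: "('e \<times> 'v \<times> 'v) list \<Rightarrow> ('e \<Rightarrow> 'v set) \<Rightarrow> 'e \<Rightarrow> 'v set" where
  "flips [] c = c"
| "flips ((g, s, w) # l) c = flips l (flip c g s w)"

text \<open>
  The edges are distinct, so flippability needs to be checked for the original choice only. Parity
  is preserved when every vertex occurs an even number of times.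
\<close>

definition closed_flips :: "('e \<Rightarrow> 'v set) \<Rightarrow> ('e \<times> 'v \<times> 'v) list \<Rightarrow> bool" where
  "closed_flips c l \<longleftrightarrow> distinct (map fst l) \<and> (\<forall>(g, s, w)\<in>set l. flippable c g s w) \<and>
     (\<forall>x. even (length (filter (\<lambda>(g, s, w). (x = s) \<noteq> (x = w)) l)))"

lemma flips_effect:
  assumes "valid c" "distinct (map fst l)" "\<forall>(g, s, w)\<in>set l. flippable c g s w"
  shows "valid (flips l c) \<and> (\<forall>g. g \<notin> fst ` set l \<longrightarrow> flips l c g = c g) \<and>
    (\<forall>(g, s, w)\<in>set l. flips l c g = sym_diff (c g) {s, w}) \<and>
    (\<forall>x. odd_at (flips l c) x \<longleftrightarrow>
       (odd_at c x \<noteq> odd (length (filter (\<lambda>(g, s, w). (x = s) \<noteq> (x = w)) l))))"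
  using assms
proof (induction l arbitrary: c)
  case Nil
  then show ?case by simp
next
  case (Cons a l)
  obtain g s w where a: "a = (g, s, w)" using prod_cases3 by blast
  let ?c = "flip c g s w"
  have f: "flippable c g s w" using Cons.prems a by simp
  have g: "g \<notin> fst ` set l" using Cons.prems a by simp
  have same: "?c h = c h" if "h \<in> fst ` set l" for h using that g by (metis flip_other)
  have fl: "\<forall>(h, s, w)\<in>set l. flippable ?c h s w"
  proof clarify
    fix h s' w' assume h: "(h, s', w') \<in> set l"
    then have "?c h = c h" using same by force
    then show "flippable ?c h s' w'" using Cons.prems(3) h unfolding flippable_def by auto
  qed
  have d: "distinct (map fst l)" using Cons.prems by simp
  note IH = Cons.IH[OF valid_flip[OF Cons.prems(1) f] d fl]
  have "flips l ?c g = ?c g" using IH g by blast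
  also have "\<dots> = sym_diff (c g) {s, w}" by (simp add: flip_def)
  finally have "flips l ?c g = sym_diff (c g) {s, w}" .
  moreover have "\<forall>(h, s, w)\<in>set l. flips l ?c h = sym_diff (c h) {s, w}"
  proof clarify
    fix h s' w' assume h: "(h, s', w') \<in> set l"
    then have "?c h = c h" using same by force
    moreover have "flips l ?c h = sym_diff (?c h) {s', w'}" using IH h by blast
    ultimately show "flips l ?c h = sym_diff (c h) {s', w'}" by simp
  qed
  moreover have "\<forall>h. h \<notin> fst ` set (a # l) \<longrightarrow> flips l ?c h = c h" using IH a by simp
  moreover have "\<forall>x. odd_at (flips l ?c) x \<longleftrightarrow>
       (odd_at c x \<noteq> odd (length (filter (\<lambda>(g, s, w). (x = s) \<noteq> (x = w)) (a # l))))"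
  proof
    fix x
    have "odd_at (flips l ?c) x \<longleftrightarrow>
        (odd_at ?c x \<noteq> odd (length (filter (\<lambda>(g, s, w). (x = s) \<noteq> (x = w)) l)))"
      using IH by blast
    then show "odd_at (flips l ?c) x \<longleftrightarrow>
        (odd_at c x \<noteq> odd (length (filter (\<lambda>(g, s, w). (x = s) \<noteq> (x = w)) (a # l))))"
      unfolding odd_at_flip[OF f] by (cases "(x = s) \<noteq> (x = w)") (simp_all add: a)
  qed
  moreover have "valid (flips l ?c)" using IH by blast
  ultimately show ?case using a by simp
qed

lemma closed_flips_effect:
  assumes c: "even_choice c" and l: "closed_flips c l"
  shows "even_choice (flips l c)"
    and "g \<notin> fst ` set l \<Longrightarrow> flips l c g = c g"
    and "(g, s, w) \<in> set l \<Longrightarrow> flips l c g = sym_diff (c g) {s, w}"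
proof -
  have v: "valid c" using c by (simp add: even_choice_def)
  have l': "distinct (map fst l)" "\<forall>(g, s, w)\<in>set l. flippable c g s w"
    "\<And>x. even (length (filter (\<lambda>(g, s, w). (x = s) \<noteq> (x = w)) l))"
    using l unfolding closed_flips_def by blast+
  note e = flips_effect[OF v l'(1,2)]
  show same: "g \<notin> fst ` set l \<Longrightarrow> flips l c g = c g" for g using e by blast
  show new: "(g, s, w) \<in> set l \<Longrightarrow> flips l c g = sym_diff (c g) {s, w}" for g s w using e by blast
  have "flips l c g \<noteq> {}" if g: "g \<in> E" for g
  proof (cases "g \<in> fst ` set l")
    case True
    then obtain s w where sw: "(g, s, w) \<in> set l" by force
    then have "flippable c g s w" using l'(2) by blast
    then have "card (flips l c g) = 2" using flip_pair(1)[OF v] new[OF sw] by simp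
    then show ?thesis by (metis card.empty zero_neq_numeral)
  next
    case False
    then show ?thesis using same c g by (simp add: even_choice_def)
  qed
  moreover have "\<not> odd_at (flips l c) x" for x
    using e l'(3)[of x] c unfolding even_choice_def by blast
  ultimately show "even_choice (flips l c)" using e unfolding even_choice_def by blast
qed

lemma flippable_sym: "flippable c g s w \<longleftrightarrow> flippable c g w s"
  unfolding flippable_def by (auto simp: insert_commute)

lemma closed_flips_2:
  assumes "g \<noteq> h" "flippable c g x y" "flippable c h x y"
  shows "closed_flips c [(g, x, y), (h, y, x)]"
  using assms flippable_sym[of c h x y] unfolding closed_flips_def by auto

lemma closed_flips_3:
  assumes "distinct [g1, g2, g3]" "flippable c g1 x y" "flippable c g2 y z" "flippable c g3 z x"
  shows "closed_flips c [(g1, x, y), (g2, y, z), (g3, z, x)]"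
  using assms unfolding closed_flips_def by auto

lemma closed_flips_4:
  assumes "distinct [g1, g2, g3, g4]" "flippable c g1 x y" "flippable c g2 y z"
    "flippable c g3 z t" "flippable c g4 t x"
  shows "closed_flips c [(g1, x, y), (g2, y, z), (g3, z, t), (g4, t, x)]"
  using assms unfolding closed_flips_def by auto

text \<open>
  When the new picks matter one by one, it is convenient to have the choice after the flips as an
  opaque \<open>d\<close>.
\<close>

lemma flip_3_cycle:
  assumes "even_choice c" "distinct [g1, g2, g3]"
    "flippable c g1 x y" "flippable c g2 y z" "flippable c g3 z x"
  obtains d where "even_choice d" "d g1 = sym_diff (c g1) {x, y}" "d g2 = sym_diff (c g2) {y, z}"
    "d g3 = sym_diff (c g3) {z, x}" "\<And>g. g \<notin> {g1, g2, g3} \<Longrightarrow> d g = c g"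
proof -
  note eff = closed_flips_effect[OF assms(1) closed_flips_3[OF assms(2-5)]]
  show ?thesis by (rule that[OF eff(1) eff(3) eff(3) eff(3) eff(2)]) simp_all
qed

lemma flip_4_cycle:
  assumes "even_choice c" "distinct [g1, g2, g3, g4]"
    "flippable c g1 x y" "flippable c g2 y z" "flippable c g3 z t" "flippable c g4 t x"
  obtains d where "even_choice d" "d g1 = sym_diff (c g1) {x, y}" "d g2 = sym_diff (c g2) {y, z}"
    "d g3 = sym_diff (c g3) {z, t}" "d g4 = sym_diff (c g4) {t, x}"
    "\<And>g. g \<notin> {g1, g2, g3, g4} \<Longrightarrow> d g = c g"
proof -
  note eff = closed_flips_effect[OF assms(1) closed_flips_4[OF assms(2-6)]]
  show ?thesis by (rule that[OF eff(1) eff(3) eff(3) eff(3) eff(3) eff(2)]) simp_all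
qed

end

section \<open>A largest linked set\<close>

locale largest_component = triple_cover V E ends
  for V :: "'v set" and E :: "'e set" and ends :: "'e \<Rightarrow> 'v set" +
  fixes c :: "'e \<Rightarrow> 'v set" and B :: "'v set"
  assumes even_c: "even_choice c" and B_sub: "B \<subseteq> V"
    and B_linked: "u \<in> B \<Longrightarrow> v \<in> B \<Longrightarrow> linked E c u v"
    and largest: "even_choice d \<Longrightarrow> X \<subseteq> V \<Longrightarrow>
      (\<And>u v. u \<in> X \<Longrightarrow> v \<in> X \<Longrightarrow> linked E d u v) \<Longrightarrow> card X \<le> card B"
begin

lemma finite_B: "finite B"
  using B_sub finite_V by (rule finite_subset)

lemmas pick = even_choice_pair[OF even_c]

lemma not_larger:
  assumes "even_choice d" "X \<subseteq> V" "x0 \<in> X" "\<And>u. u \<in> X \<Longrightarrow> linked E d u x0"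
  shows "card X \<le> card B"
proof (rule largest[OF assms(1,2)])
  fix u v assume "u \<in> X" "v \<in> X"
  then have "linked E d u x0" "linked E d v x0" using assms(4) by auto
  then show "linked E d u v" by (metis linked_trans linked_sym)
qed

lemma no_growth:
  assumes d: "even_choice d" and x0: "x0 \<in> B" "\<And>u. u \<in> B \<Longrightarrow> linked E d u x0"
    and q: "q \<in> V" "q \<notin> B" "linked E d q x0"
  shows False
proof -
  have "card (insert q B) \<le> card B"
    using d B_sub x0 q by (intro not_larger[of d _ x0]) auto
  then show False using q finite_B by simp
qed

lemma pick_closed:
  assumes "g \<in> E" "x \<in> c g" "x \<in> B"
  shows "c g \<subseteq> B"
proof
  fix y assume y: "y \<in> c g"
  show "y \<in> B"
  proof (rule ccontr)
    assume "y \<notin> B"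
    then show False
      using no_growth[OF even_c assms(3), of y] B_linked[OF _ assms(3)] y
        pick(3)[OF assms(1)] linked_edge[where c = c, OF assms(1) y assms(2)] by blast
  qed
qed

lemma pick_dichotomy: "g \<in> E \<Longrightarrow> c g \<subseteq> B \<or> c g \<inter> B = {}"
  using pick_closed by blast

lemma pick_meets: "g \<in> E \<Longrightarrow> c g \<subseteq> B \<Longrightarrow> c g \<inter> B \<noteq> {}"
  using pick(1) by (metis card.empty inf.absorb1 zero_neq_numeral)

lemma cross_flippable:
  assumes "g \<in> E" "q \<in> ends g" "b \<in> ends g" "q \<notin> B" "b \<in> B"
  shows "flippable c g q b"
  using assms pick_closed[of g b] unfolding flippable_def by auto

text \<open>
  The pick of an edge lies on one side of \<open>B\<close>, so exchanging a vertex across the border makes it a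
  pair across the border.
\<close>

lemma cross_flip:
  assumes f: "flippable c g q b" and q: "q \<notin> B" and b: "b \<in> B"
  obtains p y where "p \<in> V" "p \<notin> B" "y \<in> B"
    "p \<in> sym_diff (c g) {q, b}" "y \<in> sym_diff (c g) {q, b}"
proof -
  have g: "g \<in> E" "q \<in> ends g" using f by (auto simp: flippable_def)
  have "\<not> c g \<subseteq> {x}" for x
    using pick(1)[OF g(1)] card_mono[of "{x}" "c g"] by auto
  then obtain x y where x: "x \<in> c g" "x \<noteq> q" and y: "y \<in> c g" "y \<noteq> b" by blast
  from pick_dichotomy[OF g(1)] show ?thesis
  proof
    assume "c g \<subseteq> B"
    then show ?thesis using that[of q y] y q b g ends_subset by blast
  next
    assume "c g \<inter> B = {}"
    then show ?thesis using that[of x b] x q b pick(3)[OF g(1)] by blast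
  qed
qed

lemma B_stays_linked:
  assumes "\<And>g x y. g \<in> E \<Longrightarrow> c g \<subseteq> B \<Longrightarrow> x \<in> c g \<Longrightarrow> y \<in> c g \<Longrightarrow> linked E d x y"
    and "u \<in> B" "v \<in> B"
  shows "linked E d u v"
  using linked_transfer[OF B_linked[OF assms(2,3)] assms(2), of E d] pick_closed assms(1) by blast

text \<open>
  Losing one pair does not disconnect \<open>B\<close>, as it is no bridge; the flip across the border then links a
  new vertex to \<open>B\<close>. Hence such a closed walk of flips cannot exist.
\<close>

lemma cheap_flips:
  assumes l: "closed_flips c l" and cheap: "\<And>g. g \<in> fst ` set l \<Longrightarrow> g = g0 \<or> c g \<inter> B = {}"
    and cross: "(h, q, b) \<in> set l" "q \<notin> B" "b \<in> B"
  shows False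
proof -
  let ?d = "flips l c"
  note eff = closed_flips_effect[OF even_c l]
  have B: "linked E ?d x y" if g: "g \<in> E" "c g \<subseteq> B" "x \<in> c g" "y \<in> c g" for g x y
  proof (cases "g \<in> fst ` set l")
    case False
    then show ?thesis using linked_edge[of g E x ?d y] eff(2) g by simp
  next
    case True
    \<comment> \<open>The one affected pair inside \<open>B\<close> was not a bridge.\<close>
    then have g0: "g = g0" using cheap[OF True] pick_meets g by blast
    have "linked E ?d x y \<and> y \<in> B"
    proof (rule linked_transfer[OF no_bridge[OF even_c g(1,3,4)]])
      fix k x' y' assume k: "k \<in> E - {g}" "c k \<subseteq> B" "x' \<in> c k" "y' \<in> c k"
      then have "k \<notin> fst ` set l" using cheap[of k] pick_meets[of k] g0 by blast
      then show "linked E ?d x' y'" using linked_edge[of k E x' ?d y'] eff(2) k by simp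
    qed (use g pick_closed in blast)+
    then show ?thesis ..
  qed
  have f: "flippable c h q b" using l cross(1) unfolding closed_flips_def by blast
  then have h: "h \<in> E" by (simp add: flippable_def)
  obtain p y where p: "p \<in> V" "p \<notin> B" "y \<in> B" "p \<in> ?d h" "y \<in> ?d h"
    using cross_flip[OF f cross(2,3)] eff(3)[OF cross(1)] by metis
  have "linked E ?d u y" if "u \<in> B" for u
    using B_stays_linked[OF B that p(3)] .
  then show False
    using no_growth[OF eff(1) p(3) _ p(1,2)] linked_edge[where c = ?d, OF h p(4,5)] by blast
qed

lemma linked_through:
  assumes "\<And>g. g \<in> F \<Longrightarrow> c g \<subseteq> X \<Longrightarrow> g \<in> E \<and> d g = c g" "F \<subseteq> E" "X = B \<or> X = - B"
    and "linked F c u v" "u \<in> X"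
  shows "linked E d u v"
proof -
  have "linked E d u v \<and> v \<in> X"
  proof (rule linked_transfer[OF assms(4,5)])
    fix g x assume "g \<in> F" "x \<in> c g" "x \<in> X"
    then show "c g \<subseteq> X" using pick_dichotomy[of g] assms(2,3) by blast
  next
    fix g x y assume g: "g \<in> F" "c g \<subseteq> X" "x \<in> c g" "y \<in> c g"
    then show "linked E d x y" using assms(1)[OF g(1,2)] linked_edge[of g E x d y] by simp
  qed
  then show ?thesis ..
qed

text \<open>
  The form in which growth is used when two pairs inside \<open>B\<close> are affected: it suffices to link their
  endpoints to a vertex \<open>q\<close> outside \<open>B\<close>.
\<close>

lemma grown_by:
  assumes d: "even_choice d" and q: "q \<in> V - B" and b: "b \<in> B"
    and hub: "\<And>g x. g \<in> E \<Longrightarrow> c g \<subseteq> B \<Longrightarrow> x \<in> c g \<Longrightarrow> d g = c g \<or> linked E d x q"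
    and bq: "linked E d b q"
  shows False
proof -
  have edge: "linked E d x y" if g: "g \<in> E" "c g \<subseteq> B" "x \<in> c g" "y \<in> c g" for g x y
  proof (cases "d g = c g")
    case True
    then show ?thesis using g linked_edge[of g E x d y] by simp
  next
    case False
    then have "linked E d x q" "linked E d y q" using hub g by blast+
    then show ?thesis using linked_trans linked_sym by metis
  qed
  have "linked E d u b" if "u \<in> B" for u
    by (rule B_stays_linked[OF _ that b]) (rule edge)
  then show False using no_growth[OF d b, of q] q linked_sym[OF bq] by blast
qed

section \<open>Flips across the border of the largest linked set\<close>

text \<open>
  For \<open>q\<close> outside and \<open>b\<close> inside \<open>B\<close>, flipping the edge leaves the pairs inside \<open>B\<close> untouched.
\<close>

definition free :: "'e \<Rightarrow> 'v \<Rightarrow> 'v \<Rightarrow> bool" where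
  "free g q b \<longleftrightarrow> g \<in> E \<and> q \<in> ends g \<and> b \<in> ends g \<and> c g \<inter> B = {}"

text \<open>
  For \<open>q\<close> outside and \<open>b\<close> inside \<open>B\<close>, the flip costs \<open>B\<close> the pair \<open>c g\<close>.
\<close>

definition costly :: "'e \<Rightarrow> 'v \<Rightarrow> 'v \<Rightarrow> bool" where
  "costly g q b \<longleftrightarrow> g \<in> E \<and> q \<in> ends g \<and> b \<in> ends g \<and> c g \<subseteq> B"

lemma free_or_costly:
  assumes "q \<in> V - B" "b \<in> B"
  obtains g where "free g q b" | g where "costly g q b"
  using cover[of q b] assms B_sub pick_dichotomy unfolding free_def costly_def by blast

lemma free_shape:
  assumes "free g q b" "q \<notin> B" "b \<in> B"
  obtains q' where "ends g = {q, q', b}" "c g = {q, q'}" "q' \<in> V - B" "q' \<noteq> q"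
proof -
  have g: "g \<in> E" "q \<in> ends g" "b \<in> ends g" "c g \<inter> B = {}" "q \<noteq> b"
    using assms by (auto simp: free_def)
  obtain t where t: "ends g = {q, b, t}" "t \<noteq> q" "t \<noteq> b" "t \<in> V"
    using third_vertex[OF g(1,2,3,5)] by blast
  have "c g \<subseteq> {q, b, t}" using pick(2)[OF g(1)] t(1) by simp
  then have "c g = {q, t}" using pair_in_triple[of "c g" q b t] pick(1)[OF g(1)] g(4) assms(3) by blast
  then show ?thesis using that[of t] t g(4) by (auto simp: insert_commute)
qed

lemma costly_shape:
  assumes "costly g q b" "q \<notin> B" "b \<in> B"
  obtains b' where "ends g = {q, b, b'}" "c g = {b, b'}" "b' \<in> B" "b' \<noteq> b"
proof -
  have g: "g \<in> E" "q \<in> ends g" "b \<in> ends g" "c g \<subseteq> B" "q \<noteq> b"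
    using assms by (auto simp: costly_def)
  obtain t where t: "ends g = {q, b, t}" "t \<noteq> q" "t \<noteq> b" "t \<in> V"
    using third_vertex[OF g(1,2,3,5)] by blast
  have "c g \<subseteq> {q, b, t}" using pick(2)[OF g(1)] t(1) by simp
  then have "c g = {b, t}" using pair_in_triple[of "c g" q b t] pick(1)[OF g(1)] g(4) assms(2) by blast
  then show ?thesis using that[of t] t g(4) by auto
qed

lemma free_flippable: "free g q b \<Longrightarrow> q \<notin> B \<Longrightarrow> b \<in> B \<Longrightarrow> flippable c g q b"
  unfolding free_def using cross_flippable by blast

lemma costly_flippable: "costly g q b \<Longrightarrow> q \<notin> B \<Longrightarrow> b \<in> B \<Longrightarrow> flippable c g q b"
  unfolding costly_def using cross_flippable by blast

text \<open>
  Two edges flipped along the same two vertices form a closed walk, of which at most \<open>h\<close> affects \<open>B\<close>.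
\<close>

lemma free_only_flip:
  assumes "q \<notin> B" "b \<in> B" "free g q b" "flippable c h q b"
  shows "g = h"
proof (rule ccontr)
  assume "g \<noteq> h"
  from closed_flips_2[OF this free_flippable[OF assms(3,1,2)] assms(4)] show False
    by (rule cheap_flips[where ?g0.0 = h and h = g and q = q and b = b])
       (use assms in \<open>auto simp: free_def\<close>)
qed

lemma free_not_costly: "q \<notin> B \<Longrightarrow> b \<in> B \<Longrightarrow> free g q b \<Longrightarrow> \<not> costly h q b"
  using free_only_flip[OF _ _ _ costly_flippable, of q b g h] pick_meets[of h]
  unfolding free_def costly_def by auto

lemma free_unique: "q \<notin> B \<Longrightarrow> b \<in> B \<Longrightarrow> free g q b \<Longrightarrow> free h q b \<Longrightarrow> g = h"
  using free_only_flip free_flippable by blast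

lemma free_one_label:
  assumes "free g q b" "q \<notin> B" "b \<in> B" "b' \<in> ends g" "b' \<in> B"
  shows "b' = b"
  using free_shape[OF assms(1-3)] assms(2-5) by blast

lemma no_cheap_flip_3_cycle:
  assumes "flippable c g1 q b" "flippable c g2 b y" "flippable c g3 y q" "distinct [g1, g2, g3]"
    and "q \<notin> B" "b \<in> B" and "\<And>g. g \<in> {g1, g2, g3} \<Longrightarrow> g = g0 \<or> c g \<inter> B = {}"
  shows False
  by (rule cheap_flips[OF closed_flips_3[OF assms(4,1-3)], where ?g0.0 = g0 and h = g1 and q = q and b = b])
     (use assms(5-7) in auto)

lemma no_cheap_flip_4_cycle:
  assumes "flippable c g1 q b" "flippable c g2 b y" "flippable c g3 y z" "flippable c g4 z q"
    and "distinct [g1, g2, g3, g4]"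
    and "q \<notin> B" "b \<in> B" and "\<And>g. g \<in> {g1, g2, g3, g4} \<Longrightarrow> g = g0 \<or> c g \<inter> B = {}"
  shows False
  by (rule cheap_flips[OF closed_flips_4[OF assms(5,1-4)], where ?g0.0 = g0 and h = g1 and q = q and b = b])
     (use assms(6-8) in auto)

text \<open>
  Otherwise the closed walk \<open>q b b'\<close> would affect \<open>B\<close> by \<open>k\<close> alone.
\<close>

lemma free_labels_pick:
  assumes q: "q \<notin> B" and b: "b \<in> B" "b' \<in> B" "b \<noteq> b'" and gh: "free g q b" "free h q b'"
    and k: "k \<in> E" "b \<in> ends k" "b' \<in> ends k"
  shows "c k = {b, b'}"
proof (rule ccontr)
  assume "c k \<noteq> {b, b'}"
  then have fk: "flippable c k b b'" using k b by (simp add: flippable_def)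
  have "g \<noteq> k" "h \<noteq> k" "g \<noteq> h"
    using free_one_label[OF gh(1) q b(1)] free_one_label[OF gh(2) q b(2)] b k gh
    unfolding free_def by metis+
  then show False
    using no_cheap_flip_3_cycle[OF free_flippable[OF gh(1) q b(1)] fk, of h k]
      free_flippable[OF gh(2) q b(2)] flippable_sym[of c h q b'] q b gh
    unfolding free_def by auto
qed

section \<open>Every edge meets the largest linked set\<close>

lemma outside_flip_pick_outside:
  assumes "flippable c k q r" "q \<notin> B" "r \<notin> B"
  shows "c k \<inter> B = {}"
proof -
  have k: "k \<in> E" "q \<noteq> r" "q \<in> ends k" "r \<in> ends k" "c k \<noteq> {q, r}"
    using assms by (auto simp: flippable_def)
  obtain t where t: "ends k = {q, r, t}" using third_vertex[OF k(1,3,4,2)] by blast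
  then have "c k = {q, t} \<or> c k = {r, t}"
    using pair_in_triple[of "c k" q r t] pick(1,2)[OF k(1)] k(5) by auto
  then show ?thesis using pick_closed[OF k(1)] assms by blast
qed

lemma outside_flip_free_free:
  assumes k: "flippable c k q r" and q: "q \<notin> B" "r \<notin> B" and b: "b \<in> B"
    and gh: "free g q b" "free h r b"
  shows "g = h"
proof (rule ccontr)
  assume ne: "g \<noteq> h"
  have k': "k \<in> E" "q \<in> ends k" "r \<in> ends k" "q \<noteq> r" "c k \<noteq> {q, r}"
    using k by (auto simp: flippable_def)
  have ck: "c k \<inter> B = {}" using outside_flip_pick_outside[OF k q] .
  have "k \<noteq> g"
  proof
    assume "k = g"
    then show False using free_unique[OF q(2) b _ gh(2), of g] k' gh(1) ne
      unfolding free_def by blast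
  qed
  moreover have "k \<noteq> h"
  proof
    assume "k = h"
    then show False using free_unique[OF q(1) b _ gh(1), of h] k' gh(2) ne
      unfolding free_def by blast
  qed
  ultimately show False
    using no_cheap_flip_3_cycle[OF free_flippable[OF gh(1) q(1) b], of h r k g]
      free_flippable[OF gh(2) q(2) b] flippable_sym[of c h r b] flippable_sym[of c k q r]
      k q b gh ck ne unfolding free_def by auto
qed

lemma outside_flip_free_costly:
  assumes k: "flippable c k q r" and q: "q \<notin> B" "r \<notin> B" and b: "b \<in> B"
    and gh: "free g q b" "costly h r b"
  shows False
proof -
  have k': "k \<in> E" "q \<in> ends k" "r \<in> ends k" "q \<noteq> r"
    using k by (auto simp: flippable_def)
  have ck: "c k \<inter> B = {}" using outside_flip_pick_outside[OF k q] .
  have hB: "c h \<inter> B \<noteq> {}" using gh(2) pick_meets unfolding costly_def by blast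
  have "k \<noteq> g"
  proof
    assume "k = g"
    then show False using free_not_costly[OF q(2) b, of g h] gh(2) k' gh(1)
      unfolding free_def by blast
  qed
  moreover have "k \<noteq> h" using ck hB by blast
  moreover have "g \<noteq> h" using hB gh(1) unfolding free_def by blast
  ultimately show False
    using no_cheap_flip_3_cycle[OF free_flippable[OF gh(1) q(1) b], of h r k h]
      costly_flippable[OF gh(2) q(2) b] flippable_sym[of c h r b] flippable_sym[of c k q r]
      k q b gh ck unfolding free_def by auto
qed

text \<open>
  The last vertex of \<open>B\<close> added to a largest proper subset that is connected by its own pairs can be
  removed again without disconnecting the rest.
\<close>

lemma non_cut_vertex:
  assumes "B \<noteq> {}"
  obtains b where "b \<in> B"
    "\<And>u v. u \<in> B - {b} \<Longrightarrow> v \<in> B - {b} \<Longrightarrow> linked {g \<in> E. b \<notin> c g} c u v"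
proof -
  define con where "con U \<longleftrightarrow> U \<subset> B \<and> (\<forall>u\<in>U. \<forall>v\<in>U. linked {g \<in> E. c g \<subseteq> U} c u v)" for U
  \<comment> \<open>The empty set is admitted so that a one-element \<open>B\<close> needs no separate argument.\<close>
  have "con {}" using assms by (auto simp: con_def)
  moreover have "\<forall>U. con U \<longrightarrow> card U < Suc (card B)"
    using finite_B by (auto simp: con_def intro!: le_imp_less_Suc card_mono)
  ultimately obtain U where U: "con U" "\<forall>X. con X \<longrightarrow> card X \<le> card U"
    using ex_has_greatest_nat[of con "{}" card "Suc (card B)"] by blast
  have UB: "U \<subset> B" and Ul: "\<And>u v. u \<in> U \<Longrightarrow> v \<in> U \<Longrightarrow> linked {g \<in> E. c g \<subseteq> U} c u v"
    using U(1) by (auto simp: con_def)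
  have "\<exists>y\<in>B - U. \<forall>u\<in>insert y U. \<forall>v\<in>insert y U. linked {g \<in> E. c g \<subseteq> insert y U} c u v"
  proof (cases "U = {}")
    case True
    then show ?thesis using assms by auto
  next
    case False
    then obtain u v where uv: "u \<in> U" "v \<in> B" "v \<notin> U" using UB by blast
    have "linked E c u v" using B_linked uv UB by blast
    then obtain g x y where g: "g \<in> E" "x \<in> c g" "y \<in> c g" "x \<in> U" "y \<notin> U"
      using linked_exit uv by metis
    have yB: "y \<in> B" using pick_closed g UB by blast
    let ?F = "{g \<in> E. c g \<subseteq> insert y U}"
    have "c g = {x, y}" using card_2_eq_doubleton[OF pick(1)[OF g(1)]] g by blast
    then have gF: "g \<in> ?F" using g by auto
    have mono: "linked ?F c u v" if "u \<in> U" "v \<in> U" for u v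
    proof -
      have "rel {g \<in> E. c g \<subseteq> U} c \<subseteq> rel ?F c" unfolding rel_def by blast
      then show ?thesis using Ul[OF that] rtrancl_mono by blast
    qed
    have to_x: "linked ?F c u x" if "u \<in> insert y U" for u
      using that mono[OF _ g(4)] linked_edge[where c = c, OF gF g(3,2)] by blast
    have "linked ?F c u v" if "u \<in> insert y U" "v \<in> insert y U" for u v
      using to_x[OF that(1)] linked_sym[OF to_x[OF that(2)]] by (rule linked_trans)
    then show ?thesis using yB g(5) by (intro bexI[of _ y]) simp_all
  qed
  then obtain y where y: "y \<in> B" "y \<notin> U"
    "\<And>u v. u \<in> insert y U \<Longrightarrow> v \<in> insert y U \<Longrightarrow> linked {g \<in> E. c g \<subseteq> insert y U} c u v"
    by blast
  have "card (insert y U) > card U" using y finite_subset[of U B] UB finite_B by auto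
  then have "\<not> con (insert y U)" using U(2) by (meson leD)
  then have B_eq: "B = insert y U" using y UB unfolding con_def by blast
  have "linked {g \<in> E. y \<notin> c g} c u v" if "u \<in> B - {y}" "v \<in> B - {y}" for u v
  proof -
    have "linked {g \<in> E. c g \<subseteq> U} c u v" using Ul that B_eq by blast
    moreover have "rel {g \<in> E. c g \<subseteq> U} c \<subseteq> rel {g \<in> E. y \<notin> c g} c"
      using y(2) unfolding rel_def by blast
    ultimately show ?thesis using rtrancl_mono by blast
  qed
  then show ?thesis using that y(1) by blast
qed

text \<open>
  Both affected pairs inside \<open>B\<close> contain \<open>b\<close>, and the rest of \<open>B\<close> stays connected without \<open>b\<close>.
\<close>

lemma outside_flip_costly_costly:
  assumes k: "flippable c k q r" and q: "q \<in> V - B" "r \<in> V - B" and b: "b \<in> B"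
    and non_cut: "\<And>u v. u \<in> B - {b} \<Longrightarrow> v \<in> B - {b} \<Longrightarrow> linked {g \<in> E. b \<notin> c g} c u v"
    and gh: "costly g q b" "costly h r b"
  shows False
proof -
  have qr: "q \<noteq> r" and kE: "k \<in> E" using k by (auto simp: flippable_def)
  have gE: "g \<in> E" "h \<in> E" using gh by (auto simp: costly_def)
  obtain x where x: "ends g = {q, b, x}" "c g = {b, x}" "x \<in> B" "x \<noteq> b"
    using costly_shape[OF gh(1)] q b by blast
  obtain y where y: "ends h = {r, b, y}" "c h = {b, y}" "y \<in> B" "y \<noteq> b"
    using costly_shape[OF gh(2)] q b by blast
  have ck: "c k \<inter> B = {}" using outside_flip_pick_outside[OF k] q by blast
  have ne: "distinct [g, h, k]" using ck x y q qr b by auto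
  have fl: "flippable c g q b" "flippable c h b r" "flippable c k r q"
    using costly_flippable[OF gh(1)] costly_flippable[OF gh(2)] q b k flippable_sym by auto
  obtain d where d: "even_choice d" "d g = sym_diff (c g) {q, b}" "d h = sym_diff (c h) {b, r}"
      "d k = sym_diff (c k) {r, q}" "\<And>j. j \<notin> {g, h, k} \<Longrightarrow> d j = c j"
    by (rule flip_3_cycle[OF even_c ne fl]) (rule that; (assumption | simp))
  have dg: "q \<in> d g" "x \<in> d g" unfolding d(2) x(2) using x q b by auto
  have dh: "r \<in> d h" "y \<in> d h" unfolding d(3) y(2) using y q b by auto
  have rest: "linked E d u v \<and> v \<in> B" if "u \<in> B - {b}" "v \<in> B - {b}" for u v
  proof (rule linked_transfer[OF non_cut[OF that]])
    fix j s t assume j: "j \<in> {g \<in> E. b \<notin> c g}" "c j \<subseteq> B" "s \<in> c j" "t \<in> c j"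
    then have "j \<notin> {g, h, k}" using x(2) y(2) ck by blast
    then have "d j = c j" by (rule d(5))
    then show "linked E d s t" using linked_edge[of j E s d t] j by simp
  qed (use that pick_closed in blast)+
  \<comment> \<open>Only \<open>b\<close> may get lost, while \<open>q\<close> and \<open>r\<close> are gained.\<close>
  let ?X = "insert q (insert r (B - {b}))"
  have "linked E d q x" using linked_edge[where c = d, OF gE(1) dg] .
  moreover have "linked E d r x"
    using linked_trans[OF linked_edge[where c = d, OF gE(2) dh]] rest[of y x] x y by blast
  ultimately have "linked E d u x" if "u \<in> ?X" for u using that rest[of u x] x by blast
  then have "card ?X \<le> card B"
    using d(1) B_sub q x by (intro not_larger[of d ?X x]) auto
  moreover have "card ?X = Suc (Suc (card (B - {b})))"
    using q qr finite_B by simp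
  ultimately show False using card_Suc_Diff1[OF finite_B b] by simp
qed

lemma no_edge_outside:
  assumes "B \<noteq> {}" "g \<in> E"
  shows "ends g \<inter> B \<noteq> {}"
proof
  assume dis: "ends g \<inter> B = {}"
  obtain x y where xy: "c g = {x, y}" "x \<noteq> y" using pick(1)[OF assms(2)] by (auto simp: card_2_iff)
  obtain z where z: "ends g = {x, y, z}" "z \<noteq> x" "z \<noteq> y"
  proof -
    have "x \<in> ends g" "y \<in> ends g" using pick(2)[OF assms(2)] xy(1) by simp_all
    from third_vertex[OF assms(2) this xy(2)] show ?thesis using that by metis
  qed
  have out: "x \<in> V - B" "y \<in> V - B" "z \<in> V - B" using dis z(1) ends_subset[OF assms(2)] by auto
  \<comment> \<open>The third vertex \<open>z\<close> can be flipped with both \<open>x\<close> and \<open>y\<close>. Seen from a non-cut vertex \<open>b\<close>, this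
    forces \<open>x\<close>, \<open>y\<close>, \<open>z\<close> to be free at \<open>b\<close> through one and the same edge, which is too small.\<close>
  have fl: "flippable c g z x" "flippable c g z y"
    using xy z assms(2) by (auto simp: flippable_def doubleton_eq_iff)
  obtain b where b: "b \<in> B"
    "\<And>u v. u \<in> B - {b} \<Longrightarrow> v \<in> B - {b} \<Longrightarrow> linked {g \<in> E. b \<notin> c g} c u v"
    using non_cut_vertex[OF assms(1)] by blast
  have fl': "flippable c g x z" "flippable c g y z" using fl flippable_sym by auto
  have free: "\<exists>h. free h p b" if p: "p \<in> {x, y, z}" for p
  proof (rule ccontr)
    assume np: "\<not> ?thesis"
    have pV: "p \<in> V - B" using p out by blast
    then obtain h where h: "costly h p b" using free_or_costly[OF pV b(1)] np by blast
    obtain p' where p': "flippable c g p p'" "p' \<in> V - B"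
      using p fl fl' out by (elim insertE emptyE) (metis (no_types))+
    have nc: "\<not> costly h' p' b" for h'
    proof
      assume "costly h' p' b"
      from outside_flip_costly_costly[OF p'(1) pV p'(2) b(1) _ h this] b(2) show False by blast
    qed
    obtain h' where "free h' p' b" using free_or_costly[OF p'(2) b(1)] nc by blast
    then show False
      using outside_flip_free_costly[of g p' p b h' h] p' h pV b(1) flippable_sym[of c g p p']
      by blast
  qed
  obtain hx where hx: "free hx x b" using free[of x] by blast
  obtain hy where hy: "free hy y b" using free[of y] by blast
  obtain hz where hz: "free hz z b" using free[of z] by blast
  have "hz = hx" by (rule outside_flip_free_free[OF fl(1) _ _ b(1) hz hx]) (use out in auto)
  moreover have "hz = hy" by (rule outside_flip_free_free[OF fl(2) _ _ b(1) hz hy]) (use out in auto)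
  ultimately have sub: "{x, y, z, b} \<subseteq> ends hz" using hx hy hz unfolding free_def by simp
  have "hz \<in> E" using hz by (simp add: free_def)
  then have "card {x, y, z, b} \<le> 3"
    using card_mono[OF finite_subset[OF ends_subset finite_V] sub] card_ends[of hz] by simp
  moreover have "b \<noteq> x" "b \<noteq> y" "b \<noteq> z" using out b(1) by blast+
  ultimately show False using xy(2) z(2,3) by simp
qed

lemma outside_pair:
  assumes "B \<noteq> {}" "q \<in> V - B" "r \<in> V - B" "q \<noteq> r"
  obtains g b where "g \<in> E" "b \<in> B" "ends g = {q, r, b}" "c g = {q, r}"
proof -
  obtain g where g: "g \<in> E" "q \<in> ends g" "r \<in> ends g" using cover assms by blast
  obtain b where b: "ends g = {q, r, b}" "b \<noteq> q" "b \<noteq> r"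
    using third_vertex[OF g assms(4)] by blast
  have bB: "b \<in> B" using no_edge_outside[OF assms(1) g(1)] b assms by auto
  have "c g = {q, r} \<or> c g = {q, b} \<or> c g = {r, b}"
    using pair_in_triple[of "c g" q r b] pick(1,2)[OF g(1)] b by auto
  moreover have "\<not> c g = {q, b}" "\<not> c g = {r, b}" using pick_closed[OF g(1), of b] bB assms by auto
  ultimately have "c g = {q, r}" by blast
  then show ?thesis using that g bB b by blast
qed

section \<open>At most one vertex is outside the largest linked set\<close>

text \<open>
  The closed walk \<open>q w b\<close> replaces the pairs \<open>{w, w'}\<close>, \<open>{b, b'}\<close> of \<open>B\<close> by \<open>{q, w'}\<close>, \<open>{w, b'}\<close>
  and a link from \<open>b\<close> to \<open>q\<close>. The hypothesis on \<open>L\<close> excludes the one way in which \<open>B\<close> could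
  fall into two parts that these links do not rejoin.
\<close>

lemma double_swap:
  assumes q: "q \<in> V - B" and b: "b \<in> B" "b' \<in> B" "b \<noteq> b'" and h: "free h q b"
    and k: "k \<in> E" "ends k = {b, b', w}" "c k = {b, b'}" and w: "w \<in> B" "w \<noteq> b" "w \<noteq> b'"
    and l: "l \<in> E" "ends l = {q, w, w'}" "c l = {w, w'}" and w': "w' \<in> B" "w' \<noteq> w"
    and L: "L = linked (E - {l, k}) c" "L w w' \<and> L b b' \<or> L w b \<and> L w' b'"
  shows False
proof -
  have qB: "q \<notin> B" using q by blast
  obtain q' where q': "ends h = {q, q', b}" "c h = {q, q'}" "q' \<in> V - B" "q' \<noteq> q"
    by (rule free_shape[OF h qB b(1)])
  have hE: "h \<in> E" using h by (simp add: free_def)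
  have "q \<notin> ends k" using k(2) b w qB by auto
  then have "l \<noteq> k" using l(2) by auto
  moreover have hlk: "h \<noteq> l" "h \<noteq> k" using q'(2,3) qB l(3) k(3) w b by auto
  ultimately have ne: "distinct [l, k, h]" by auto
  have "{b, b'} \<noteq> {w, b}" using w b by (auto simp: doubleton_eq_iff)
  then have fk: "flippable c k w b" using k w by (auto simp: flippable_def)
  have fl: "flippable c l q w" using cross_flippable[of l q w] l qB w by auto
  have fh: "flippable c h b q" using free_flippable[OF h qB b(1)] flippable_sym by blast
  obtain d where d: "even_choice d" "d l = sym_diff (c l) {q, w}" "d k = sym_diff (c k) {w, b}"
      "d h = sym_diff (c h) {b, q}" and same: "\<And>j. j \<notin> {l, k, h} \<Longrightarrow> d j = c j"
    by (rule flip_3_cycle[OF even_c ne fl fk fh]) (rule that; (assumption | simp))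
  have "q \<in> d l" "w' \<in> d l" unfolding d(2) l(3) using w w' qB by auto
  then have w'q: "linked E d w' q" using linked_edge[of l E w' d q] l(1) by simp
  have "w \<in> d k" "b' \<in> d k" unfolding d(3) k(3) using w b by auto
  then have wb': "linked E d w b'" using linked_edge[of k E w d b'] k(1) by simp
  have "b \<in> d h" "q' \<in> d h" unfolding d(4) q'(2) using q' qB b by auto
  then have bq': "linked E d b q'" using linked_edge[of h E b d q'] hE by simp
  have "linked (E - {h}) c q' q" using no_bridge[OF even_c hE] q'(2) by simp
  then have "linked E d q' q"
  proof (rule linked_through[rotated -2])
    fix g assume g: "g \<in> E - {h}" "c g \<subseteq> - B"
    then have "g \<notin> {l, k, h}" using l(3) k(3) w b by auto
    then show "g \<in> E \<and> d g = c g" using g(1) same by blast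
  qed (use q' in auto)
  with bq' have bq: "linked E d b q" by (rule linked_trans)
  have LB: "linked E d x y" if "L x y" "x \<in> B" for x y
  proof (rule linked_through)
    show "linked (E - {l, k}) c x y" using that(1) L(1) by simp
    fix g assume g: "g \<in> E - {l, k}" "c g \<subseteq> B"
    then have "g \<notin> {l, k, h}" using q'(2) qB by auto
    then show "g \<in> E \<and> d g = c g" using g(1) same by blast
  qed (use that in auto)
  have wq: "linked E d w q" and b'q: "linked E d b' q"
  proof -
    show wq: "linked E d w q"
      using L(2) LB[of w w'] LB[of w b] w(1) linked_trans[OF _ w'q] linked_trans[OF _ bq] by blast
    show "linked E d b' q" using linked_trans[OF linked_sym[OF wb'] wq] .
  qed
  show False
  proof (rule grown_by[OF d(1) q b(1) _ bq])
    fix g x assume g: "g \<in> E" "c g \<subseteq> B" "x \<in> c g"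
    show "d g = c g \<or> linked E d x q"
    proof (cases "g \<in> {l, k}")
      case True
      then show ?thesis using g(3) l(3) k(3) wq w'q bq b'q by auto
    next
      case False
      then have "g \<notin> {l, k, h}" using g(2) q'(2) qB by auto
      then show ?thesis using same by blast
    qed
  qed
qed

text \<open>
  With \<open>w\<close> in \<open>B\<close>, both \<open>q w b\<close> and \<open>q w b'\<close> are closed walks of flips, and at least one of them
  keeps \<open>B\<close> together.
\<close>

lemma third_not_in_B:
  assumes q: "q \<in> V - B" and b: "b \<in> B" "b' \<in> B" "b \<noteq> b'" and h: "free h q b" "free h' q b'"
    and k: "k \<in> E" "ends k = {b, b', w}" "c k = {b, b'}" and w: "w \<noteq> b" "w \<noteq> b'"
  shows "w \<notin> B"
proof
  assume wB: "w \<in> B"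
  have qB: "q \<notin> B" using q by blast
  have "\<not> free g q w" for g
  proof
    assume "free g q w"
    from free_labels_pick[OF qB b(1) wB w(1)[symmetric] h(1) this k(1)]
    have "c k = {b, w}" using k(2) by simp
    then show False using k(3) w b by (auto simp: doubleton_eq_iff)
  qed
  then obtain l where l: "costly l q w" using free_or_costly[OF q wB] by blast
  obtain w' where w': "ends l = {q, w, w'}" "c l = {w, w'}" "w' \<in> B" "w' \<noteq> w"
    by (rule costly_shape[OF l qB wB])
  have lE: "l \<in> E" using l by (simp add: costly_def)
  define L where "L = linked (E - {l, k}) c"
  \<comment> \<open>Of the three ways of \<open>two_removed\<close> to reconnect, each of the two cycles handles two, and
    together they handle all of them.\<close>
  have no1: "\<not> (L w w' \<and> L b b' \<or> L w b \<and> L w' b')"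
    using double_swap[OF q b h(1) k wB w lE w' L_def] by blast
  have k': "ends k = {b', b, w}" "c k = {b', b}" using k by auto
  have no2: "\<not> (L w w' \<and> L b' b \<or> L w b' \<and> L w' b)"
    using double_swap[OF q b(2,1) b(3)[symmetric] h(2) k(1) k' wB w(2,1) lE w' L_def] by blast
  show False
    using two_removed[OF even_c lE w'(2) k(1,3) L_def] no1 no2 by blast
qed

text \<open>
  With \<open>w\<close> outside \<open>B\<close>, the walk \<open>q b w a\<close> affects two pairs of \<open>B\<close>, but it
  links all their endpoints to vertices outside \<open>B\<close>, and these are linked among themselves.
\<close>

lemma third_in_B:
  assumes B: "B \<noteq> {}" and q: "q \<in> V - B"
    and b: "b \<in> B" "b' \<in> B" "b \<noteq> b'" and h: "free h q b" "free h' q b'"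
    and k: "k \<in> E" "ends k = {b, b', w}" "c k = {b, b'}"
  shows "w \<in> B"
proof (rule ccontr)
  assume wB: "w \<notin> B"
  have wV: "w \<in> V - B" using wB k(1,2) ends_subset[of k] by auto
  have qB: "q \<notin> B" using q by blast
  have kw: "costly k w b" "costly k w b'" using k b by (auto simp: costly_def)
  obtain q' where q': "ends h = {q, q', b}" "c h = {q, q'}" "q' \<in> V - B" "q' \<noteq> q"
    by (rule free_shape[OF h(1) qB b(1)])
  obtain p where p: "ends h' = {q, p, b'}" "c h' = {q, p}" "p \<in> V - B" "p \<noteq> q"
    by (rule free_shape[OF h(2) qB b(2)])
  have hE: "h \<in> E" "h' \<in> E" "c h \<inter> B = {}" "c h' \<inter> B = {}" using h by (auto simp: free_def)
  have "free h q' b" "free h' p b'" using q' p hE by (auto simp: free_def)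
  moreover have nf: "\<not> free g w b" "\<not> free g w b'" for g
    using free_not_costly[OF wB b(1), of g k] free_not_costly[OF wB b(2), of g k] kw by blast+
  ultimately have wne: "w \<noteq> q" "w \<noteq> q'" "w \<noteq> p" using h(1) by metis+
  \<comment> \<open>The route back from \<open>w\<close> to \<open>q\<close> goes through the third vertex \<open>a\<close> of an edge over \<open>w\<close> and \<open>q'\<close>;
    it avoids \<open>q\<close>, hence is not the edge of the flip from \<open>a\<close> to \<open>q\<close>.\<close>
  obtain m a where m: "m \<in> E" "a \<in> B" "ends m = {w, q', a}" "c m = {w, q'}"
    using outside_pair[OF B wV q'(3) wne(2)] by blast
  have mw: "free m w a" using m wB q' by (auto simp: free_def)
  have ab: "a \<noteq> b" using nf(1) mw by blast
  have kB: "c k \<inter> B \<noteq> {}" using k(3) b by auto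
  have mB: "c m \<inter> B = {}" using mw by (simp add: free_def)
  have qk: "q \<notin> ends k" using k(2) b qB wne by auto
  have qm: "q \<notin> ends m" using m qB wne q' by auto
  have wh: "w \<notin> ends h" using q' wne wB b by auto
  have f: "flippable c h q b" "flippable c k b w" "flippable c m w a"
    using free_flippable[OF h(1) qB b(1)] costly_flippable[OF kw(1) wB b(1)]
      free_flippable[OF mw wB m(2)] flippable_sym by blast+
  have hkm: "distinct [h, k, m]" using hE(3) kB mB wh m(3) by auto
  \<comment> \<open>If the last flip were free, \<open>k\<close> would be the only affected edge inside \<open>B\<close>.\<close>
  have "\<not> free l q a" for l
  proof
    assume l: "free l q a"
    have fl: "flippable c l a q" using free_flippable[OF l qB m(2)] flippable_sym by blast
    have "l \<noteq> h" using free_one_label[OF l qB m(2), of b] b(1) q'(1) ab by auto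
    moreover have "l \<noteq> k" "l \<noteq> m" using l qk qm by (auto simp: free_def)
    ultimately have "distinct [h, k, m, l]" using hkm by auto
    from no_cheap_flip_4_cycle[OF f fl this qB b(1), of k] show False
      using hE(3) mB l by (auto simp: free_def)
  qed
  then obtain l where l: "costly l q a" using free_or_costly[OF q m(2)] by blast
  obtain a' where a': "ends l = {q, a, a'}" "c l = {a, a'}" "a' \<in> B" "a' \<noteq> a"
    by (rule costly_shape[OF l qB m(2)])
  have lE: "l \<in> E" and lB: "c l \<inter> B \<noteq> {}" using l a' by (auto simp: costly_def)
  have "l \<notin> {h, k, m}" using lB hE(3) mB a'(1) qk by auto
  then have ne: "distinct [h, k, m, l]" using hkm by auto
  have fl: "flippable c l a q" using costly_flippable[OF l qB m(2)] flippable_sym by blast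
  obtain d where d: "even_choice d" "d h = sym_diff (c h) {q, b}" "d k = sym_diff (c k) {b, w}"
      "d m = sym_diff (c m) {w, a}" "d l = sym_diff (c l) {a, q}"
      and same: "\<And>j. j \<notin> {h, k, m, l} \<Longrightarrow> d j = c j"
    by (rule flip_4_cycle[OF even_c ne f fl]) (rule that; (assumption | simp))
  have "b \<in> d h" "q' \<in> d h" unfolding d(2) q'(2) using q' qB b by auto
  then have bq': "linked E d b q'" using linked_edge[of h E b d q'] hE(1) by simp
  have "b' \<in> d k" "w \<in> d k" unfolding d(3) k(3) using b wB by auto
  then have b'w: "linked E d b' w" using linked_edge[of k E b' d w] k(1) by simp
  have "a \<in> d m" "q' \<in> d m" unfolding d(4) m(4) using m(2) q' wB wne by auto
  then have aq': "linked E d a q'" using linked_edge[of m E a d q'] m(1) by simp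
  have "a' \<in> d l" "q \<in> d l" unfolding d(5) a'(2) using m(2) a' qB by auto
  then have a'q: "linked E d a' q" using linked_edge[of l E a' d q] lE by simp
  have keep: "linked E d x y"
    if g: "g \<in> E" "c g = {x, y}" "x \<notin> B" "y \<notin> B" "g \<noteq> h" "g \<noteq> m" for g x y
  proof -
    have "g \<notin> {h, k, m, l}" using g kB lB by auto
    then have "d g = c g" by (rule same)
    then show ?thesis using linked_edge[of g E x d y] g(1,2) by simp
  qed
  \<comment> \<open>Outside \<open>B\<close> any two vertices form the pick of some edge, and enough of these survive to link
    \<open>w\<close> and \<open>q'\<close> to \<open>q\<close>. For \<open>q'\<close>, whose picks with \<open>q\<close> and \<open>w\<close> may both
    be gone, the link starts with \<open>h'\<close>.\<close>
  have wq: "linked E d w q"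
  proof -
    obtain n z where n: "n \<in> E" "z \<in> B" "ends n = {w, q, z}" "c n = {w, q}"
      using outside_pair[OF B wV q wne(1)] by blast
    show ?thesis by (rule keep[OF n(1,4) wB qB]) (use n(3) wh qm in auto)
  qed
  have qp: "linked E d q p"
  proof (rule keep[OF hE(2) p(2) qB])
    show "h' \<noteq> h" using free_one_label[OF h(2) qB b(2), of b] b q'(1) by auto
    show "h' \<noteq> m" using p(1) qm by auto
  qed (use p in auto)
  have pq': "linked E d p q'"
  proof (cases "p = q'")
    case False
    obtain n z where n: "n \<in> E" "z \<in> B" "ends n = {p, q', z}" "c n = {p, q'}"
      using outside_pair[OF B p(3) q'(3) False] by blast
    have "q \<notin> ends n" "w \<notin> ends n" using n p q' qB wB wne by auto
    moreover have "q \<in> ends h" "w \<in> ends m" using q'(1) m(3) by auto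
    ultimately have "n \<noteq> h" "n \<noteq> m" by metis+
    then show ?thesis using keep[OF n(1,4)] p(3) q'(3) by blast
  qed simp
  have q'q: "linked E d q' q" using linked_sym[OF linked_trans[OF qp pq']] .
  have hub: "linked E d b q" "linked E d b' q" "linked E d a q"
    using linked_trans[OF bq' q'q] linked_trans[OF b'w wq] linked_trans[OF aq' q'q] .
  show False
  proof (rule grown_by[OF d(1) q b(1) _ hub(1)])
    fix g x assume g: "g \<in> E" "c g \<subseteq> B" "x \<in> c g"
    show "d g = c g \<or> linked E d x q"
    proof (cases "g \<in> {k, l}")
      case True
      then show ?thesis using g(3) k(3) a'(2) hub a'q by auto
    next
      case False
      have "g \<noteq> h" "g \<noteq> m" using g(2,3) hE(3) mB by auto
      then show ?thesis using same[of g] False by auto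
    qed
  qed
qed

lemma outside_unique:
  assumes B: "B \<noteq> {}" and q: "q \<in> V - B" and r: "r \<in> V - B"
  shows "q = r"
proof (rule ccontr)
  assume "q \<noteq> r"
  then obtain h0 where h0: "h0 \<in> E" "q \<in> c h0" using outside_pair[OF B q r] by blast
  let ?A = "{g \<in> E. q \<in> c g}"
  \<comment> \<open>The degree of \<open>q\<close> is even and positive, so \<open>q\<close> lies in two picks, which yield two labels.\<close>
  have "?A \<noteq> {h0}"
  proof
    assume "?A = {h0}"
    then have "card ?A = 1" by simp
    then show False using even_choice_card[OF even_c, of q] by simp
  qed
  then obtain h1 where h1: "h1 \<in> E" "q \<in> c h1" "h1 \<noteq> h0" using h0 by blast
  have qB: "q \<notin> B" using q by blast
  have lab: "\<exists>b\<in>B. free h q b" if h: "h \<in> E" "q \<in> c h" for h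
  proof -
    have "c h \<inter> B = {}" using pick_dichotomy[OF h(1)] h(2) qB by blast
    moreover have "q \<in> ends h" using pick(2)[OF h(1)] h(2) by blast
    ultimately show ?thesis using no_edge_outside[OF B h(1)] h(1) unfolding free_def by blast
  qed
  obtain b where b: "b \<in> B" "free h0 q b" using lab[OF h0] by blast
  obtain b' where b': "b' \<in> B" "free h1 q b'" using lab[OF h1(1,2)] by blast
  have bb: "b \<noteq> b'" using free_unique[OF qB b(1) b(2), of h1] b' h1(3) by blast
  obtain k where k: "k \<in> E" "b \<in> ends k" "b' \<in> ends k"
    using cover[of b b'] b(1) b'(1) bb B_sub by blast
  have ck: "c k = {b, b'}" by (rule free_labels_pick[OF qB b(1) b'(1) bb b(2) b'(2) k])
  obtain w where w: "ends k = {b, b', w}" "w \<noteq> b" "w \<noteq> b'" "w \<in> V"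
    by (rule third_vertex[OF k bb])
  show False
    using third_not_in_B[OF q b(1) b'(1) bb b(2) b'(2) k(1) w(1) ck w(2,3)]
      third_in_B[OF B q b(1) b'(1) bb b(2) b'(2) k(1) w(1) ck] by blast
qed

lemma all_picks_in_B:
  assumes "B \<noteq> {}" "g \<in> E"
  shows "c g \<subseteq> B"
proof (rule ccontr)
  assume "\<not> c g \<subseteq> B"
  then have "c g \<subseteq> V - B" using pick_dichotomy[OF assms(2)] pick(3)[OF assms(2)] by blast
  moreover obtain x y where "c g = {x, y}" "x \<noteq> y"
    using pick(1)[OF assms(2)] by (auto simp: card_2_iff)
  ultimately show False using outside_unique[OF assms(1), of x y] by auto
qed

end

context triple_cover
begin

lemma connected_even_choice_exists:
  assumes "2 \<le> card E"
  obtains c where "even_choice c"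
    "\<And>g h x y. g \<in> E \<Longrightarrow> h \<in> E \<Longrightarrow> x \<in> c g \<Longrightarrow> y \<in> c h \<Longrightarrow> linked E c x y"
proof -
  define P where "P = (\<lambda>(c, X). even_choice c \<and> X \<subseteq> V \<and> (\<forall>u\<in>X. \<forall>v\<in>X. linked E c u v))"
  obtain c0 where c0: "even_choice c0" using even_choice_exists[OF assms] by blast
  obtain g0 where g0: "g0 \<in> E" using assms by fastforce
  obtain v where v: "v \<in> V"
    using card_ends[OF g0] ends_subset[OF g0] by (metis card.empty subset_empty zero_neq_numeral all_not_in_conv)
  have start: "P (c0, {v})" using c0 v by (simp add: P_def)
  have bound: "\<forall>p. P p \<longrightarrow> card (snd p) < Suc (card V)"
    using finite_V by (auto simp: P_def intro!: le_imp_less_Suc card_mono)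
  obtain p where p: "P p" "\<forall>p'. P p' \<longrightarrow> card (snd p') \<le> card (snd p)"
    using ex_has_greatest_nat[of P, OF start bound] by blast
  obtain c B where cB: "p = (c, B)" by (cases p)
  interpret largest_component V E ends c B
  proof unfold_locales
    show "even_choice c" "B \<subseteq> V" "\<And>u v. u \<in> B \<Longrightarrow> v \<in> B \<Longrightarrow> linked E c u v"
      using p(1) unfolding P_def cB by auto
    fix d X assume "even_choice d" "X \<subseteq> V" "\<And>u v. u \<in> X \<Longrightarrow> v \<in> X \<Longrightarrow> linked E d u v"
    then have "P (d, X)" by (simp add: P_def)
    then show "card X \<le> card B" using p(2) cB by fastforce
  qed
  \<comment> \<open>Singletons are linked, so the maximum is not attained by the empty set.\<close>
  have "1 \<le> card B" using p(2) start cB by fastforce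
  then have "B \<noteq> {}" by auto
  then have "linked E c x y" if "g \<in> E" "h \<in> E" "x \<in> c g" "y \<in> c h" for g h x y
    using all_picks_in_B[of g] all_picks_in_B[of h] that B_linked by blast
  then show ?thesis using that even_c by blast
qed

end

section \<open>Euler circuits and Euler tours\<close>

fun trail :: "('e \<Rightarrow> 'v set) \<Rightarrow> 'v \<Rightarrow> 'e list \<Rightarrow> 'v \<Rightarrow> bool" where
  "trail c u [] w \<longleftrightarrow> u = w"
| "trail c u (g # gs) w \<longleftrightarrow> (\<exists>v. u \<noteq> v \<and> c g = {u, v} \<and> trail c v gs w)"

lemma trail_append:
  "trail c u (gs @ hs) w \<longleftrightarrow> (\<exists>v. trail c u gs v \<and> trail c v hs w)"
  by (induction gs arbitrary: u) auto

lemma trail_parity: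
  assumes "trail c u gs w" "distinct gs"
  shows "odd (card {g \<in> set gs. x \<in> c g}) \<longleftrightarrow> (x = u) \<noteq> (x = w)"
  using assms
proof (induction gs arbitrary: u)
  case Nil
  then show ?case by simp
next
  case (Cons g gs)
  then obtain v where v: "u \<noteq> v" "c g = {u, v}" "trail c v gs w" by auto
  have "{h \<in> set (g # gs) - {g}. x \<in> c h} = {h \<in> set gs. x \<in> c h}" using Cons.prems(2) by auto
  then have "odd (card {h \<in> set (g # gs). x \<in> c h}) \<longleftrightarrow>
      (x \<in> c g) \<noteq> odd (card {h \<in> set gs. x \<in> c h})"
    using odd_card_split[of "set (g # gs)" g "\<lambda>h. x \<in> c h"] by simp
  then show ?case using Cons.IH[OF v(3)] Cons.prems(2) v(1,2) by auto
qed

lemma trail_split: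
  assumes "trail c u gs w" "g \<in> set gs" "x \<in> c g"
  shows "\<exists>gs1 gs2. gs = gs1 @ gs2 \<and> trail c u gs1 x \<and> trail c x gs2 w"
  using assms
proof (induction gs arbitrary: u)
  case Nil
  then show ?case by simp
next
  case (Cons h gs)
  then obtain v where v: "u \<noteq> v" "c h = {u, v}" "trail c v gs w" by auto
  consider "x = u" | "x = v" | "g \<in> set gs" using Cons.prems v by auto
  then show ?case
  proof cases
    case 1
    then have "h # gs = [] @ (h # gs) \<and> trail c u [] x \<and> trail c x (h # gs) w"
      using Cons.prems(1) by simp
    then show ?thesis by (intro exI)
  next
    case 2
    then have "h # gs = [h] @ gs \<and> trail c u [h] x \<and> trail c x gs w" using v by simp
    then show ?thesis by (intro exI)
  next
    case 3
    then obtain gs1 gs2 where "gs = gs1 @ gs2" "trail c v gs1 x" "trail c x gs2 w"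
      using Cons.IH[OF v(3)] Cons.prems(3) by blast
    then have "h # gs = (h # gs1) @ gs2 \<and> trail c u (h # gs1) x \<and> trail c x gs2 w"
      using v by auto
    then show ?thesis by (intro exI)
  qed
qed

lemma trail_vertices:
  assumes "trail c u gs w"
  shows "\<exists>vs. length vs = Suc (length gs) \<and> hd vs = u \<and> last vs = w \<and>
    (\<forall>i<length gs. vs ! i \<noteq> vs ! Suc i \<and> c (gs ! i) = {vs ! i, vs ! Suc i})"
  using assms
proof (induction gs arbitrary: u)
  case Nil
  then show ?case by (intro exI[of _ "[u]"]) simp
next
  case (Cons g gs)
  then obtain v where v: "u \<noteq> v" "c g = {u, v}" "trail c v gs w" by auto
  obtain vs where vs: "length vs = Suc (length gs)" "hd vs = v" "last vs = w"
    "\<forall>i<length gs. vs ! i \<noteq> vs ! Suc i \<and> c (gs ! i) = {vs ! i, vs ! Suc i}"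
    using Cons.IH[OF v(3)] by blast
  have "vs \<noteq> []" using vs(1) by auto
  then have "vs ! 0 = v" using vs(2) by (simp add: hd_conv_nth)
  then have "(u # vs) ! i \<noteq> (u # vs) ! Suc i \<and> c ((g # gs) ! i) = {(u # vs) ! i, (u # vs) ! Suc i}"
    if "i < length (g # gs)" for i
    using that vs(4) v(1,2) by (cases i) auto
  then show ?case using vs(1,3) \<open>vs \<noteq> []\<close> by (intro exI[of _ "u # vs"]) simp
qed

context triple_cover
begin

text \<open>
  A longest trail cannot be extended, so by parity it is closed; and it contains every edge that
  touches it, since it could be rotated and extended otherwise.
\<close>

lemma euler_circuit:
  assumes c: "even_choice c" and ne: "E \<noteq> {}"
    and con: "\<And>g h x y. g \<in> E \<Longrightarrow> h \<in> E \<Longrightarrow> x \<in> c g \<Longrightarrow> y \<in> c h \<Longrightarrow> linked E c x y"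
  obtains u gs where "trail c u gs u" "distinct gs" "set gs = E"
proof -
  define P where "P = (\<lambda>(u, gs, w). trail c u gs w \<and> distinct gs \<and> set gs \<subseteq> E)"
  obtain g0 where g0: "g0 \<in> E" using ne by blast
  obtain a b where ab: "c g0 = {a, b}" "a \<noteq> b"
    using even_choice_pair(1)[OF c g0] by (auto simp: card_2_iff)
  have start: "P (a, [g0], b)" using g0 ab by (auto simp: P_def)
  let ?len = "\<lambda>p :: 'v \<times> 'e list \<times> 'v. length (fst (snd p))"
  have "length gs < Suc (card E)" if "distinct gs" "set gs \<subseteq> E" for gs
    using card_mono[OF finite_E that(2)] distinct_card[OF that(1)] by simp
  then have bound: "\<forall>p. P p \<longrightarrow> ?len p < Suc (card E)" by (auto simp: P_def)
  obtain p where p: "P p" "\<forall>p'. P p' \<longrightarrow> ?len p' \<le> ?len p"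
    using ex_has_greatest_nat[of P, OF start bound] by blast
  obtain u gs w where pe: "p = (u, gs, w)" by (cases p)
  have gs: "trail c u gs w" "distinct gs" "set gs \<subseteq> E" using p(1) by (auto simp: P_def pe)
  have longest: "length hs \<le> length gs" if "trail c u' hs w'" "distinct hs" "set hs \<subseteq> E" for u' hs w'
  proof -
    have "P (u', hs, w')" using that by (simp add: P_def)
    then show ?thesis using p(2) pe by fastforce
  qed
  have no_ext: "g \<in> set hs"
    if hs: "trail c u' hs w'" "distinct hs" "set hs \<subseteq> E" "length hs = length gs"
      and g: "g \<in> E" "w' \<in> c g" for g u' hs w'
  proof (rule ccontr)
    assume new: "g \<notin> set hs"
    obtain s t where "c g = {s, t}" "s \<noteq> t"
      using even_choice_pair(1)[OF c g(1)] by (auto simp: card_2_iff)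
    then obtain v where v: "c g = {w', v}" "v \<noteq> w'"
      using g(2) by (metis insertE insert_commute singletonD)
    have "trail c u' (hs @ [g]) v" using hs(1) v by (auto simp: trail_append)
    from longest[OF this] show False using hs g(1) new by simp
  qed
  have closed: "u = w"
  proof (rule ccontr)
    assume "u \<noteq> w"
    then have "odd (card {g \<in> set gs. w \<in> c g})" using trail_parity[OF gs(1,2)] by simp
    moreover have "{g \<in> set gs. w \<in> c g} = {g \<in> E. w \<in> c g}"
      using no_ext[OF gs refl] gs(3) by blast
    ultimately show False using even_choice_card[OF c] by simp
  qed
  \<comment> \<open>A longest trail is closed and may be rotated to end at any of its vertices.\<close>
  have touch: "g \<in> set gs" if g: "g \<in> E" "h \<in> set gs" "x \<in> c h" "x \<in> c g" for g h x
  proof -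
    obtain gs1 gs2 where s: "gs = gs1 @ gs2" "trail c u gs1 x" "trail c x gs2 w"
      using trail_split[OF gs(1) g(2,3)] by blast
    then have "trail c x (gs2 @ gs1) x" using closed trail_append by metis
    then have "g \<in> set (gs2 @ gs1)" using no_ext[of x "gs2 @ gs1" x g] gs s(1) g(1,4) by auto
    then show ?thesis using s(1) by auto
  qed
  have "gs \<noteq> []" using longest[of a "[g0]" b] start by (auto simp: P_def)
  then obtain h where h: "h \<in> set gs" by (cases gs) auto
  have hE: "h \<in> E" using h gs(3) by blast
  have "\<exists>x. x \<in> c g" if "g \<in> E" for g
    using even_choice_pair(1)[OF c that] by (metis card.empty ex_in_conv zero_neq_numeral)
  note nonempty = this
  obtain x where x: "x \<in> c h" using nonempty[OF hE] by blast
  have "g \<in> set gs" if g: "g \<in> E" for g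
  proof -
    obtain y where y: "y \<in> c g" using nonempty[OF g] by blast
    have "\<exists>k\<in>set gs. z \<in> c k" if "linked E c x z" for z
      using that
    proof (induction rule: rtrancl_induct)
      case base
      then show ?case using h x by blast
    next
      case (step y z)
      then obtain k where k: "k \<in> E" "y \<in> c k" "z \<in> c k" by (auto simp: rel_def)
      then show ?case using step.IH touch[OF k(1)] by blast
    qed
    from this[OF con[OF hE g x y]] show ?thesis using touch[OF g _ _ y] by blast
  qed
  then have "set gs = E" using gs(3) by blast
  then show ?thesis using that gs(1,2) closed by blast
qed

end

lemma covering_3_hypergraph_triple_cover:
  assumes "covering_3_hypergraph H"
  shows "triple_cover (verts H) (edges H) (ends H)"
proof
  note H = assms[unfolded covering_3_hypergraph_def is_hypergraph_def]
  show "finite (verts H)" "finite (edges H)" using H by blast+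
  show "ends H g \<subseteq> verts H" "card (ends H g) = 3" if "g \<in> edges H" for g using H that by blast+
  show "\<exists>g\<in>edges H. u \<in> ends H g \<and> v \<in> ends H g"
    if "u \<in> verts H" "v \<in> verts H" "u \<noteq> v" for u v
  proof -
    have "{u, v} \<subseteq> verts H" "card {u, v} = 2" using that by auto
    then have "\<exists>g\<in>edges H. {u, v} \<subseteq> ends H g" using H by blast
    then show ?thesis by blast
  qed
qed

lemma count_list_distinct: "distinct xs \<Longrightarrow> x \<in> set xs \<Longrightarrow> count_list xs x = 1"
  by (induction xs) auto

lemma covering_3_hypergraph_eulerian:
  assumes "covering_3_hypergraph H" "2 \<le> card (edges H)"
  shows "eulerian H"
proof -
  interpret triple_cover "verts H" "edges H" "ends H"
    using covering_3_hypergraph_triple_cover[OF assms(1)] .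
  obtain c where c: "even_choice c" "\<And>g h x y. g \<in> edges H \<Longrightarrow> h \<in> edges H \<Longrightarrow>
      x \<in> c g \<Longrightarrow> y \<in> c h \<Longrightarrow> linked (edges H) c x y"
    by (rule connected_even_choice_exists[OF assms(2)]) (rule that; assumption)
  have ne: "edges H \<noteq> {}" using assms(2) by auto
  obtain u es where es: "trail c u es u" "distinct es" "set es = edges H"
    by (rule euler_circuit[OF c(1) ne c(2)])
  obtain vs where vs: "length vs = Suc (length es)" "hd vs = u" "last vs = u"
    "\<And>i. i < length es \<Longrightarrow> vs ! i \<noteq> vs ! Suc i \<and> c (es ! i) = {vs ! i, vs ! Suc i}"
    using trail_vertices[OF es(1)] by blast
  have step: "vs ! i \<in> ends H (es ! i) \<and> vs ! Suc i \<in> ends H (es ! i)" if "i < length es" for i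
    using vs(4)[OF that] even_choice_pair(2)[OF c(1), of "es ! i"] es(3) nth_mem[OF that] by auto
  have "set vs \<subseteq> verts H"
  proof
    fix x assume "x \<in> set vs"
    then obtain i where i: "i \<le> length es" "x = vs ! i"
      using vs(1) by (metis in_set_conv_nth less_Suc_eq_le)
    have "es \<noteq> []" using ne es(3) by auto
    then obtain j where "j < length es" "x \<in> ends H (es ! j)"
    proof (cases "i < length es")
      case True
      then show ?thesis using that[of i] step[of i] i(2) by blast
    next
      case False
      then obtain j where "i = Suc j" "j < length es" using i(1) \<open>es \<noteq> []\<close>
        by (cases i) auto
      then show ?thesis using that[of j] step[of j] i(2) by blast
    qed
    then show "x \<in> verts H" using ends_subset[of "es ! j"] es(3) nth_mem by blast
  qed
  then have "walk H vs es" unfolding walk_def using vs(1,4) step es(3) by simp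
  moreover have "count_list es e = 1" if "e \<in> edges H" for e
    using that es(2,3) count_list_distinct by metis
  ultimately have "euler_tour H vs es"
    unfolding euler_tour_def closed_walk_def strict_trail_def using vs(2,3) es(2) by simp
  then show ?thesis unfolding eulerian_def by blast
qed

text \<open>
  A tour with a single edge would have to return to its start in one step.
\<close>

lemma eulerian_card_edges:
  assumes "eulerian H" "edges H \<noteq> {}"
  shows "2 \<le> card (edges H)"
proof -
  obtain vs es where t: "euler_tour H vs es" using assms(1) by (auto simp: eulerian_def)
  then have w: "walk H vs es" "hd vs = last vs" and d: "distinct es"
    and cnt: "\<And>e. e \<in> edges H \<Longrightarrow> count_list es e = 1"
    by (auto simp: euler_tour_def closed_walk_def strict_trail_def)
  have es: "set es = edges H"
  proof
    show "set es \<subseteq> edges H" using w(1) by (simp add: walk_def)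
    show "edges H \<subseteq> set es" using cnt by (metis count_notin subsetI zero_neq_one)
  qed
  then have len: "card (edges H) = length es" using distinct_card[OF d] by simp
  have "length es \<noteq> 1"
  proof
    assume 1: "length es = 1"
    then have "length vs = Suc (Suc 0)" using w(1) by (simp add: walk_def)
    then obtain a b where "vs = [a, b]" by (auto simp: length_Suc_conv)
    then show False using w 1 by (auto simp: walk_def)
  qed
  moreover have "length es \<noteq> 0" using es assms(2) by auto
  ultimately show ?thesis using len by linarith
qed

theorem theorem5p0p1:
  fixes H :: "('v, 'e) hypergraph"
  assumes "covering_3_hypergraph H"
  shows "eulerian H \<longleftrightarrow> card (edges H) \<ge> 2"
  using covering_3_hypergraph_eulerian[OF assms] eulerian_card_edges[of H] assms
  unfolding covering_3_hypergraph_def is_hypergraph_def by blast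

end
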